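(* Let $d,k,r$ be positive integers with $k<\min\{d,r\}$. Then, as $n\to\infty$, $L(n,d,k,r)=\Theta(l_{d,k,r}(n))$, where $$l_{d,k,r}(n) = \begin{cases} n^{k\cdot\max\{r,d\}}, & \text{if } r\ne d,\\ n^{kd}\log n, & \text{otherwise.}\end{cases}$$
   Context: $[n]=\{1,\dots,n\}$. $L(n,d,k,r)$ is the number of ordered $r$-tuples of (not necessarily distinct) points in $[n]^d$ that lie in a common $k$-dimensional linear subspace of $\mathbb{R}^d$; equivalently, the number of $d\times r$ matrices with entries in $[n]$ of rank at most $k$. Here $d,k,r$ are fixed and implied constants may depend on them. *)

theory Defs
  imports "HOL-Analysis.Analysis" "HOL-Library.Landau_Symbols"
begin

text \<open>
  The ambient space is \<^typ>\<open>real^'d\<close>, so the dimension \<open>d\<close> is \<open>CARD('d)\<close>; the positions of an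
  ordered \<open>r\<close>-tuple are indexed by a finite type \<open>'r\<close>, so \<open>r\<close> is \<open>CARD('r)\<close>.
\<close>

definition grid :: "nat \<Rightarrow> (real^'d::finite) set" where
  "grid n = {x. \<forall>i. x $ i \<in> of_nat ` {1..n}}"

definition L_count :: "nat \<Rightarrow> 'd::finite itself \<Rightarrow> nat \<Rightarrow> 'r::finite itself \<Rightarrow> nat" where
  "L_count n (_ :: 'd itself) k (_ :: 'r itself) =
     card {X :: (real^'d)^'r. (\<forall>j. X $ j \<in> grid n) \<and>
             (\<exists>V. subspace V \<and> dim V = k \<and> (\<forall>j. X $ j \<in> V))}"

definition l_bound :: "nat \<Rightarrow> nat \<Rightarrow> nat \<Rightarrow> nat \<Rightarrow> real" where
  "l_bound d k r n = (if r \<noteq> d then real n ^ (k * max r d) else real n ^ (k * d) * ln (real n))"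

text \<open>
  The description of \<^const>\<open>L_count\<close> by matrices: the points of a tuple are the columns of a
  \<open>d \<times> r\<close> matrix.
\<close>

lemma in_common_subspace_iff:
  fixes X :: "(real^'d::finite)^'r::finite"
  assumes "k \<le> CARD('d)"
  shows "(\<exists>V. subspace V \<and> dim V = k \<and> (\<forall>j. X $ j \<in> V)) \<longleftrightarrow> rank (transpose X) \<le> k"
proof -
  have rk: "rank (transpose X) = dim (range (\<lambda>j. X $ j))"
    by (simp only: rank_transpose) (simp add: row_rank_def rows_def row_def full_SetCompr_eq)
  show ?thesis
  proof
    assume "\<exists>V. subspace V \<and> dim V = k \<and> (\<forall>j. X $ j \<in> V)"
    then show "rank (transpose X) \<le> k"
      unfolding rk by (metis dim_subset image_subsetI)
  next
    assume le: "rank (transpose X) \<le> k"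
    let ?S = "span (range (\<lambda>j. X $ j))"
    obtain B where B: "B \<subseteq> ?S" "independent B" "?S \<subseteq> span B" "card B = dim ?S"
      by (rule basis_exists)
    obtain C where C: "B \<subseteq> C" "independent C" "UNIV \<subseteq> span C"
      using maximal_independent_subset_extend[of B UNIV] B(2) by auto
    have "card C = CARD('d)"
      using C basis_card_eq_dim[of C UNIV] by simp
    moreover have "card B \<le> k" using B(4) le rk by simp
    ultimately obtain D where D: "B \<subseteq> D" "D \<subseteq> C" "card D = k"
      using exists_subset_between[of B k C] C assms independent_imp_finite by metis
    have "dim (span D) = k"
      using D C(2) independent_mono dim_span_eq_card_independent by metis
    moreover have "?S \<subseteq> span D" using B(3) D(1) span_mono by blast
    ultimately obtain V where "subspace V" "?S \<subseteq> V" "dim V = k"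
      using subspace_span by blast
    moreover have "X $ j \<in> ?S" for j by (simp add: span_base)
    ultimately show "\<exists>V. subspace V \<and> dim V = k \<and> (\<forall>j. X $ j \<in> V)"
      by blast
  qed
qed

lemma L_count_eq_card_rank_le:
  assumes "k \<le> CARD('d::finite)"
  shows "L_count n TYPE('d) k TYPE('r::finite) =
    card {A :: real^'r^'d. (\<forall>i j. A $ i $ j \<in> of_nat ` {1..n}) \<and> rank A \<le> k}"
  unfolding L_count_def in_common_subspace_iff[OF assms] grid_def
  by (rule bij_betw_same_card[of transpose], rule bij_betwI[where g = transpose])
     (auto simp: transpose_def)

end

theory Submission
  imports Defs "HOL-Number_Theory.Totient"
begin

text \<open>
  Upper bound, for at most as many rows as columns. Complete pivoting selects \<open>m \<le> k\<close> rows of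
  which all other rows are linear combinations with bounded coefficients \<open>\<Theta>\<close>, and the columns,
  cut down to these rows, span \<open>\<real>\<^sup>m\<close> and lie in the lattice
  \<open>\<Lambda> = {x \<in> \<int>\<^sup>m. \<Theta> x is integral}\<close>. Let \<open>D\<close> be the product of the diagonal \<open>d\<close> of a
  triangular basis of \<open>\<Lambda>\<close>. Since vectors of \<open>\<Lambda>\<close> of size \<open>n\<close> span \<open>\<real>\<^sup>m\<close>, translates of
  \<open>\<Lambda> \<inter> [-n,n]\<^sup>m\<close> by representatives of \<open>D\<close> different cosets fit into a box of side \<open>O(n)\<close>, so
  that this set has \<open>O(n\<^sup>m / D)\<close> elements. Counting the triangular bases with diagonal \<open>d\<close>, and the
  \<open>\<Theta>\<close> that are integral on them, leaves a sum over \<open>d\<close> that factors into convergent sums,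
  except for one harmonic sum if the matrix is square.

  Lower bound. If the matrix is not square, repeat one of \<open>k\<close> arbitrary rows. If it is square,
  count matrices whose rows lie in one of the subspaces \<open>x\<^sub>j = (b\<^sub>j / q) (x\<^sub>0 + \<Sum> a\<^sub>c x\<^sub>c) - integer
  combination\<close> for \<open>j \<ge> k\<close>: integrality is a single congruence modulo \<open>q\<close>, so such a subspace
  has about \<open>n\<^sup>k / q\<close> points, and the number of subspaces with denominator \<open>q\<close> is large enough for
  the sum over \<open>q\<close> to be of the order of \<open>\<Sum> \<phi>(q) / q\<^sup>2\<close>.
\<close>

section \<open>Bounded row bases\<close>

text \<open>Gaussian elimination with an entry of maximal modulus as pivot, by induction on the
  number of nonzero rows; the choice of pivot makes every multiplier \<open>u l\<close> at most 1 in
  modulus. The second conjunct expresses the independence of the selected rows dually: the columns,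
  cut down to these rows, span the whole space.\<close>

lemma bounded_row_basis:
  fixes X :: "'a::finite \<Rightarrow> 'b::finite \<Rightarrow> real"
  shows "\<exists>m e. (\<forall>l. \<exists>t. (\<Sum>i<m. \<bar>t i\<bar>) \<le> 2 ^ m - 1 \<and>
            (\<forall>j. X l j = (\<Sum>i<m. t i * X (e i) j))) \<and>
          (\<forall>c. \<exists>s. \<forall>i<m. (\<Sum>j\<in>UNIV. s j * X (e i) j) = c i)"
proof (induction "card {l. \<exists>j. X l j \<noteq> 0}" arbitrary: X rule: less_induct)
  case less
  show ?case
  proof (cases "\<forall>l j. X l j = 0")
    case True
    then show ?thesis by (intro exI[of _ 0]) auto
  next
    case False
    let ?f = "\<lambda>(l, j). \<bar>X l j\<bar>"
    have "Max (range ?f) \<in> range ?f" by (rule Max_in) auto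
    then obtain p q where pq: "Max (range ?f) = \<bar>X p q\<bar>" 
      by (elim imageE) (simp add: split_beta)
    have max: "\<bar>X l j\<bar> \<le> \<bar>X p q\<bar>" for l j
      unfolding pq[symmetric] by (rule Max_ge) (auto intro!: image_eqI[of _ _ "(l, j)"])
    then have nz: "X p q \<noteq> 0" using False by force
    define u where "u l = X l q / X p q" for l
    have u1: "\<bar>u l\<bar> \<le> 1" for l using max[of l q] nz by (simp add: u_def)
    define W where "W l j = X l j - u l * X p j" for l j
    have Wp: "W p j = 0" for j using nz by (simp add: W_def u_def)
    have Wq: "W l q = 0" for l using nz by (simp add: W_def u_def)
    have "{l. \<exists>j. W l j \<noteq> 0} \<subset> {l. \<exists>j. X l j \<noteq> 0}"
    proof
      show "{l. \<exists>j. W l j \<noteq> 0} \<subseteq> {l. \<exists>j. X l j \<noteq> 0}"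
      proof (rule Collect_mono, rule impI)
        fix l assume "\<exists>j. W l j \<noteq> 0"
        then obtain j where j: "W l j \<noteq> 0" ..
        show "\<exists>j. X l j \<noteq> 0"
        proof (rule ccontr)
          assume "\<not> ?thesis"
          then show False using j by (simp add: W_def u_def)
        qed
      qed
      show "{l. \<exists>j. W l j \<noteq> 0} \<noteq> {l. \<exists>j. X l j \<noteq> 0}"
      proof
        assume eq: "{l. \<exists>j. W l j \<noteq> 0} = {l. \<exists>j. X l j \<noteq> 0}"
        have "p \<in> {l. \<exists>j. X l j \<noteq> 0}" using nz by (intro CollectI exI)
        then have "\<exists>j. W p j \<noteq> 0" unfolding eq[symmetric] by (rule CollectD)
        then show False by (simp add: Wp)
      qed
    qed
    then have "card {l. \<exists>j. W l j \<noteq> 0} < card {l. \<exists>j. X l j \<noteq> 0}"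
      by (intro psubset_card_mono finite)
    then obtain m e where
      row: "\<And>l. \<exists>t. (\<Sum>i<m. \<bar>t i\<bar>) \<le> 2 ^ m - 1 \<and> (\<forall>j. W l j = (\<Sum>i<m. t i * W (e i) j))"
      and col: "\<And>c. \<exists>s. \<forall>i<m. (\<Sum>j\<in>UNIV. s j * W (e i) j) = c i"
      using less[of W] by blast
    let ?e = "e(m := p)"
    have "\<exists>t. (\<Sum>i<Suc m. \<bar>t i\<bar>) \<le> 2 ^ Suc m - 1 \<and> (\<forall>j. X l j = (\<Sum>i<Suc m. t i * X (?e i) j))" for l
    proof -
      from row obtain t where t: "(\<Sum>i<m. \<bar>t i\<bar>) \<le> 2 ^ m - 1"
        "\<And>j. W l j = (\<Sum>i<m. t i * W (e i) j)" by blast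
      \<comment> \<open>Expanding \<open>W (e i) j = X (e i) j - u (e i) * X p j\<close> collects
        this coefficient at the pivot row. Its modulus is at most 1 plus the sum of the others, so
        the bound passes from \<open>2 ^ m - 1\<close> to
        \<open>2 * (2 ^ m - 1) + 1\<close>.\<close>
      define t' where "t' = t(m := u l - (\<Sum>i<m. t i * u (e i)))"
      have "\<bar>\<Sum>i<m. t i * u (e i)\<bar> \<le> (\<Sum>i<m. \<bar>t i\<bar>)"
        by (rule order_trans[OF sum_abs], rule sum_mono)
           (use u1 in \<open>auto simp: abs_mult mult_left_le\<close>)
      then have "\<bar>t' m\<bar> \<le> 1 + (\<Sum>i<m. \<bar>t i\<bar>)" using u1[of l] by (simp add: t'_def)
      then have "(\<Sum>i<Suc m. \<bar>t' i\<bar>) \<le> 2 ^ Suc m - 1" using t(1) by (simp add: t'_def)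
      moreover have "X l j = (\<Sum>i<Suc m. t' i * X (?e i) j)" for j
      proof -
        have "X l j = u l * X p j + (\<Sum>i<m. t i * W (e i) j)" using t(2)[of j] by (simp add: W_def)
        also have "\<dots> = (\<Sum>i<m. t i * X (e i) j) + t' m * X p j"
          by (simp add: W_def t'_def algebra_simps sum_subtractf sum_distrib_left sum_distrib_right)
        finally show ?thesis by (simp add: t'_def)
      qed
      ultimately show ?thesis by blast
    qed
    moreover have "\<exists>s. \<forall>i<Suc m. (\<Sum>j\<in>UNIV. s j * X (?e i) j) = c i" for c
    proof -
      \<comment> \<open>The target is shifted because \<open>X (e i)\<close> is
        \<open>W (e i)\<close> plus \<open>u (e i)\<close> times the pivot row, which is to yield
        \<open>c m\<close>. Column \<open>q\<close> of \<open>W\<close> vanishes, so changing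
        \<open>s\<close> at \<open>q\<close> by \<open>a\<close> corrects the pivot row and leaves
        the equations for \<open>W\<close> intact.\<close>
      from col[of "\<lambda>i. c i - u (e i) * c m"] obtain s where
        s: "\<And>i. i < m \<Longrightarrow> (\<Sum>j\<in>UNIV. s j * W (e i) j) = c i - u (e i) * c m" by blast
      define a where "a = (c m - (\<Sum>j\<in>UNIV. s j * X p j)) / X p q"
      define s' where "s' j = s j + (if j = q then a else 0)" for j
      have s': "(\<Sum>j\<in>UNIV. s' j * f j) = (\<Sum>j\<in>UNIV. s j * f j) + a * f q" for f
      proof -
        have "s' j * f j = s j * f j + (if j = q then a * f q else 0)" for j
          by (simp add: s'_def distrib_right)
        then show ?thesis by (simp add: sum.distrib)
      qed
      have p: "(\<Sum>j\<in>UNIV. s' j * X p j) = c m" using nz by (simp add: s' a_def)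
      have "(\<Sum>j\<in>UNIV. s' j * X (e i) j) = c i" if "i < m" for i
      proof -
        have "(\<Sum>j\<in>UNIV. s' j * X (e i) j)
            = (\<Sum>j\<in>UNIV. s' j * W (e i) j) + u (e i) * (\<Sum>j\<in>UNIV. s' j * X p j)"
          by (simp add: W_def algebra_simps sum_subtractf sum_distrib_left)
        then show ?thesis using s[OF that] p by (simp add: s' Wq)
      qed
      with p show ?thesis by (intro exI[of _ s']) (auto simp: less_Suc_eq)
    qed
    ultimately show ?thesis by blast
  qed
qed

section \<open>Triangular bases of lattices\<close>

text \<open>Coordinates from \<open>m\<close> on are 0 rather than \<open>undefined\<close>, so that
  vectors can be added and subtracted pointwise.\<close>

definition vecs :: "nat \<Rightarrow> (nat \<Rightarrow> 'a::zero set) \<Rightarrow> (nat \<Rightarrow> 'a) set" where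
  "vecs m A = {x. (\<forall>i<m. x i \<in> A i) \<and> (\<forall>i\<ge>m. x i = 0)}"

lemma bij_betw_vecs: "bij_betw (\<lambda>x. restrict x {..<m}) (vecs m A) (PiE {..<m} A)"
  by (rule bij_betwI[where g = "\<lambda>x i. if i < m then x i else 0"])
     (auto simp: vecs_def fun_eq_iff PiE_def extensional_def)

lemma card_vecs: "card (vecs m A) = (\<Prod>i<m. card (A i))"
  using bij_betw_same_card[OF bij_betw_vecs, of m A] by (simp add: card_PiE)

lemma finite_vecs: "(\<And>i. i < m \<Longrightarrow> finite (A i)) \<Longrightarrow> finite (vecs m A)"
  using bij_betw_finite[OF bij_betw_vecs, of m A] finite_PiE[of "{..<m}" A] by simp

text \<open>By \<open>zero\<close> and \<open>comb\<close>, \<open>M\<close> is a subgroup of the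
  integer vectors. The assumption \<open>cover\<close> is a quantitative form of full rank: the
  covering radius in the maximum norm is at most \<open>K\<close>.\<close>

locale covering_lattice =
  fixes M :: "(nat \<Rightarrow> int) set" and m K :: nat
  assumes zero: "(\<lambda>_. 0) \<in> M"
    and supp: "x \<in> M \<Longrightarrow> m \<le> i \<Longrightarrow> x i = 0"
    and comb: "x \<in> M \<Longrightarrow> y \<in> M \<Longrightarrow> (\<lambda>i. x i - c * y i) \<in> M"
    and cover: "v \<in> vecs m (\<lambda>_. UNIV) \<Longrightarrow>
      \<exists>y\<in>M. (\<lambda>i. v i - y i) \<in> vecs m (\<lambda>_. {- int K..int K})"
begin

definition lead :: "nat \<Rightarrow> nat \<Rightarrow> bool" where
  "lead i t \<longleftrightarrow> 0 < t \<and> (\<exists>x\<in>M. x i = int t \<and> (\<forall>j>i. x j = 0))"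

text \<open>For \<open>i < m\<close> this is the diagonal of the Hermite normal form of
  \<open>M\<close>, the last nonzero coordinate being the leading one.\<close>

definition pivot :: "nat \<Rightarrow> nat" where "pivot i = (LEAST t. lead i t)"

text \<open>Pigeonhole: the multiples of the \<open>i\<close>-th unit vector leave only finitely
  many remainders modulo \<open>M\<close> in the box of radius \<open>K\<close>. Two multiples with
  the same remainder differ by an element of \<open>M\<close>.\<close>

lemma lead_pivot:
  assumes "i < m" shows "lead i (pivot i)"
proof -
  define c where "c t = (\<lambda>j. if j = i then int t else 0)" for t :: nat
  have "c t \<in> vecs m (\<lambda>_. UNIV)" for t using assms by (auto simp: vecs_def c_def)
  then have "\<forall>t. \<exists>y\<in>M. (\<lambda>i. c t i - y i) \<in> vecs m (\<lambda>_. {- int K..int K})" using cover by blast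
  then obtain y where y: "\<And>t. y t \<in> M"
    "\<And>t. (\<lambda>i. c t i - y t i) \<in> vecs m (\<lambda>_. {- int K..int K})" by metis
  have fin: "finite (vecs m (\<lambda>_. {- int K..int K}))" by (rule finite_vecs) auto
  define F where "F t = (\<lambda>i. c t i - y t i)" for t
  have "range F \<subseteq> vecs m (\<lambda>_. {- int K..int K})" using y(2) by (auto simp: F_def)
  with fin have "finite (range F)" by (rule rev_finite_subset)
  then have "\<not> inj F" by (rule contrapos_pn) (rule range_inj_infinite)
  then obtain s t where "F s = F t" "s \<noteq> t" unfolding inj_def by blast
  then obtain s t where st: "F s = F t" "s < t" by (metis linorder_neqE_nat)
  have eq: "c s j - y s j = c t j - y t j" for j using fun_cong[OF st(1), of j] by (simp add: F_def)
  have 1: "(\<lambda>j. y t j - 1 * y s j) \<in> M" by (intro comb y(1))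
  have 2: "(\<lambda>j. y t j - 1 * y s j) = c (t - s)"
  proof
    fix j show "y t j - 1 * y s j = c (t - s) j"
      using eq[of j] st(2) by (simp add: c_def of_nat_diff split: if_splits)
  qed
  have "lead i (t - s)"
    unfolding lead_def using 1[unfolded 2] st(2) by (intro conjI bexI[of _ "c (t - s)"]) (auto simp: c_def)
  then show ?thesis unfolding pivot_def by (rule LeastI)
qed

text \<open>Otherwise division with remainder produces an element of \<open>M\<close> with a smaller
  positive leading entry at \<open>i\<close>.\<close>

lemma pivot_dvd:
  assumes i: "i < m" and x: "x \<in> M" "\<And>j. j > i \<Longrightarrow> x j = 0"
  shows "int (pivot i) dvd x i"
proof (rule ccontr)
  assume nd: "\<not> ?thesis"
  from lead_pivot[OF i] obtain y where y: "y \<in> M" "y i = int (pivot i)" "\<And>j. j > i \<Longrightarrow> y j = 0"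
    and pos: "0 < pivot i" by (auto simp: lead_def)
  define z where "z = (\<lambda>j. x j - (x i div int (pivot i)) * y j)"
  have zi: "z i = x i mod int (pivot i)" by (simp add: z_def y minus_div_mult_eq_mod)
  have "x i mod int (pivot i) \<noteq> 0" using nd by (simp add: dvd_eq_mod_eq_0)
  then have z0: "z i > 0" using pos pos_mod_sign[of "int (pivot i)" "x i"] unfolding zi by linarith
  moreover have z1: "z i < int (pivot i)" unfolding zi using pos by (intro pos_mod_bound) simp
  moreover have "z \<in> M" unfolding z_def by (intro comb x y)
  ultimately have "lead i (nat (z i))"
    unfolding lead_def using x(2) y(3) by (intro conjI bexI[of _ z]) (auto simp: z_def)
  then have "pivot i \<le> nat (z i)" unfolding pivot_def by (rule Least_le)
  then show False using z0 z1 by linarith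
qed

text \<open>Hermite reduction from coordinate \<open>i - 1\<close> downwards: subtracting a multiple
  of a vector with leading coordinate \<open>l\<close> does not touch the coordinates above
  \<open>l\<close>. In the induction, \<open>t\<close> counts the coordinates already
  reduced.\<close>

lemma reduced_row:
  assumes i: "i < m"
  shows "\<exists>x\<in>M. x i = int (pivot i) \<and> (\<forall>j>i. x j = 0) \<and> (\<forall>j<i. x j \<in> {0..<int (pivot j)})"
proof -
  have "\<exists>x\<in>M. x i = int (pivot i) \<and> (\<forall>j>i. x j = 0) \<and> (\<forall>j<i. i \<le> j + t \<longrightarrow> x j \<in> {0..<int (pivot j)})"
    for t
  proof (induction t)
    case 0
    then show ?case using lead_pivot[OF i] by (auto simp: lead_def)
  next
    case (Suc t)
    then obtain x where x: "x \<in> M" "x i = int (pivot i)" "\<And>j. j > i \<Longrightarrow> x j = 0"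
      "\<And>j. j < i \<Longrightarrow> i \<le> j + t \<Longrightarrow> x j \<in> {0..<int (pivot j)}" by blast
    show ?case
    proof (cases "Suc t \<le> i")
      case False
      then show ?thesis using x by (intro bexI[of _ x]) auto
    next
      case True
      define l where "l = i - Suc t"
      have l: "l < i" "l < m" "i = l + Suc t" using True i by (auto simp: l_def)
      from lead_pivot[OF l(2)] obtain y where y: "y \<in> M" "y l = int (pivot l)" "\<And>j. j > l \<Longrightarrow> y j = 0"
        and pos: "0 < pivot l" by (auto simp: lead_def)
      define z where "z = (\<lambda>j. x j - (x l div int (pivot l)) * y j)"
      have "z \<in> M" unfolding z_def by (intro comb x y)
      moreover have zl: "z l = x l mod int (pivot l)" by (simp add: z_def y minus_div_mult_eq_mod)
      moreover have zj: "z j = x j" if "j > l" for j using y(3)[OF that] by (simp add: z_def)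
      moreover have "z j \<in> {0..<int (pivot j)}" if "j < i" "i \<le> j + Suc t" for j
      proof (cases "j = l")
        case True
        then show ?thesis using zl pos by simp
      next
        case False
        then have "j > l" "i \<le> j + t" using that l(3) by auto
        then show ?thesis using x(4) that zj by simp
      qed
      ultimately show ?thesis using x l by (intro bexI[of _ z]) auto
    qed
  qed
  from this[of i] show ?thesis by auto
qed

text \<open>A packing argument. The vectors \<open>c\<close> with
  \<open>0 \<le> c i < pivot i\<close> are pairwise incongruent modulo \<open>M\<close>, and
  \<open>c - y c\<close> is a representative of the coset of \<open>c\<close> of size at most
  \<open>K\<close>. Adding lattice points of size at most \<open>n\<close> gives distinct vectors of
  size at most \<open>K + n\<close>.\<close>

lemma prod_pivot_mult_card_le:
  "(\<Prod>i<m. pivot i) * card (M \<inter> vecs m (\<lambda>_. {- int n..int n})) \<le> (2 * (K + n) + 1) ^ m"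
proof -
  let ?R = "vecs m (\<lambda>i. {0..<int (pivot i)})" and ?N = "M \<inter> vecs m (\<lambda>_. {- int n..int n})"
  let ?B = "vecs m (\<lambda>_. {- int (K + n)..int (K + n)})"
  have "\<forall>c\<in>?R. \<exists>y\<in>M. (\<lambda>i. c i - y i) \<in> vecs m (\<lambda>_. {- int K..int K})"
    by (intro ballI cover) (auto simp: vecs_def)
  then obtain y where y: "\<And>c. c \<in> ?R \<Longrightarrow> y c \<in> M"
    "\<And>c. c \<in> ?R \<Longrightarrow> (\<lambda>i. c i - y c i) \<in> vecs m (\<lambda>_. {- int K..int K})" by metis
  define g where "g = (\<lambda>(c, x) i. c i - y c i + x i :: int)"
  have "inj_on g (?R \<times> ?N)"
  proof (rule inj_onI, clarify)
    fix c x c' x' assume a: "c \<in> ?R" "c' \<in> ?R" "x \<in> M" "x' \<in> M"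
      and eq: "g (c, x) = g (c', x')"
    have e: "c i - y c i + x i = c' i - y c' i + x' i" for i
      using fun_cong[OF eq, of i] by (simp add: g_def)
    have "(\<lambda>i. (y c i - 1 * y c' i) - 1 * (x i - 1 * x' i)) \<in> M"
      by (intro comb y a)
    moreover have "(\<lambda>i. (y c i - 1 * y c' i) - 1 * (x i - 1 * x' i)) = (\<lambda>i. c i - c' i)"
    proof
      fix i show "(y c i - 1 * y c' i) - 1 * (x i - 1 * x' i) = c i - c' i" using e[of i] by simp
    qed
    ultimately have diff: "(\<lambda>i. c i - c' i) \<in> M" by simp
    have "c = c'"
    proof (rule ccontr)
      assume "c \<noteq> c'"
      let ?I = "{i. c i \<noteq> c' i}"
      have sub: "?I \<subseteq> {..<m}" 
      proof
        fix i assume "i \<in> ?I"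
        then show "i \<in> {..<m}" using a(1,2) by (cases "i < m") (auto simp: vecs_def)
      qed
      then have fin: "finite ?I" by (rule finite_subset) simp
      moreover have "?I \<noteq> {}" using \<open>c \<noteq> c'\<close> by auto
      ultimately have mem: "Max ?I \<in> ?I" by (rule Max_in)
      \<comment> \<open>At the last coordinate where \<open>c\<close> and \<open>c'\<close> differ,
        \<open>pivot i\<close> divides a nonzero difference that is smaller than itself.\<close>
      define i where "i = Max ?I"
      have im: "i < m" and ne: "c i \<noteq> c' i" using mem sub by (auto simp: i_def)
      have "c j - c' j = 0" if "j > i" for j
        using Max_ge[OF fin, of j] that by (auto simp: i_def)
      then have "int (pivot i) dvd c i - c' i" using pivot_dvd[OF im diff] by blast
      moreover have "\<bar>c i - c' i\<bar> < int (pivot i)" using a(1,2) im by (force simp: vecs_def)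
      ultimately show False using ne dvd_imp_le_int[of "c i - c' i" "int (pivot i)"] by simp
    qed
    moreover have "x = x'"
    proof
      fix i show "x i = x' i" using e[of i] \<open>c = c'\<close> by simp
    qed
    ultimately show "c = c' \<and> x = x'" ..
  qed
  moreover have "g ` (?R \<times> ?N) \<subseteq> ?B"
  proof clarify
    fix c x assume "c \<in> ?R" "x \<in> M" "x \<in> vecs m (\<lambda>_. {- int n..int n})"
    then show "g (c, x) \<in> ?B"
      using y(2)[of c] by (force simp: vecs_def g_def)
  qed
  moreover have "finite ?B" by (rule finite_vecs) auto
  ultimately have "card (?R \<times> ?N) \<le> card ?B" by (rule card_inj_on_le)
  moreover have "nat (1 + (int K * 2 + int n * 2)) = 2 * (K + n) + 1" by simp
  ultimately show ?thesis by (simp add: card_cartesian_product card_vecs algebra_simps)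
qed

end

section \<open>Upper bound for the number of matrices\<close>

definition low_rank :: "nat \<Rightarrow> nat \<Rightarrow> ('a::finite \<Rightarrow> 'b::finite \<Rightarrow> int) set" where
  "low_rank n k = {X. (\<forall>l j. X l j \<in> {1..int n}) \<and> rank (\<chi> l j. real_of_int (X l j)) \<le> k}"

text \<open>Taking unit vectors for \<open>c\<close> gives functionals that are 1 on one selected
  row and 0 on the others. They separate the rows and extract each coefficient from a vanishing
  linear combination.\<close>

lemma le_rank_if_rows_span:
  fixes A :: "real^'b::finite^'a::finite"
  assumes span: "\<And>c. \<exists>s. \<forall>i<m. (\<Sum>j\<in>UNIV. s j * A $ e i $ j) = c i"
  shows "inj_on e {..<m}" and "m \<le> rank A"
proof -
  have sep: "\<exists>s. \<forall>i<m. (\<Sum>j\<in>UNIV. s j * A $ e i $ j) = (if i = i0 then 1 else 0)" for i0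
    by (rule span)
  have inj: "inj_on (\<lambda>i. A $ e i) {..<m}"
  proof (rule inj_onI)
    fix i i' assume i: "i \<in> {..<m}" "i' \<in> {..<m}" "A $ e i = A $ e i'"
    obtain s where s: "\<And>l. l < m \<Longrightarrow> (\<Sum>j\<in>UNIV. s j * A $ e l $ j) = (if l = i then 1 else 0)"
      using sep[of i] by blast
    have "(if i = i then 1 else 0) = (if i' = i then 1 else (0::real))"
      using s[of i] s[of i'] i by simp
    then show "i = i'" by (simp split: if_splits)
  qed
  then show "inj_on e {..<m}" by (rule inj_on_imageI2[of "\<lambda>l. A $ l", unfolded comp_def])
  have "independent ((\<lambda>i. A $ e i) ` {..<m})"
  proof (rule independent_if_scalars_zero)
    fix f x assume f: "(\<Sum>x\<in>(\<lambda>i. A $ e i) ` {..<m}. f x *\<^sub>R x) = 0"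
      and "x \<in> (\<lambda>i. A $ e i) ` {..<m}"
    then obtain i0 where i0: "i0 < m" "x = A $ e i0" by auto
    obtain s where s: "\<And>l. l < m \<Longrightarrow> (\<Sum>j\<in>UNIV. s j * A $ e l $ j) = (if l = i0 then 1 else 0)"
      using sep[of i0] by blast
    have "(\<Sum>i<m. f (A $ e i) *\<^sub>R A $ e i) = 0" using f by (simp add: sum.reindex[OF inj])
    then have "(\<Sum>i<m. f (A $ e i) * A $ e i $ j) = 0" for j
      by (auto simp: vec_eq_iff)
    then have "0 = (\<Sum>j\<in>UNIV. s j * (\<Sum>i<m. f (A $ e i) * A $ e i $ j))" by simp
    also have "\<dots> = (\<Sum>i<m. f (A $ e i) * (\<Sum>j\<in>UNIV. s j * A $ e i $ j))"
      unfolding sum_distrib_left by (subst sum.swap) (simp add: mult.left_commute)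
    also have "\<dots> = (\<Sum>i<m. if i = i0 then f (A $ e i) else 0)"
      using s by (intro sum.cong) auto
    also have "\<dots> = f x" using i0 by simp
    finally show "f x = 0" by simp
  qed simp
  moreover have "(\<lambda>i. A $ e i) ` {..<m} \<subseteq> rows A"
    by (auto simp: rows_def row_def vec_nth_inverse)
  ultimately have "card ((\<lambda>i. A $ e i) ` {..<m}) \<le> dim (rows A)"
    by (intro independent_card_le_dim)
  then show "m \<le> rank A" by (simp add: card_image[OF inj] row_rank_def)
qed

text \<open>Finiteness is carried along because \<open>card\<close> is 0 on infinite sets: the
  conclusion has the form of the premise, so that it can be applied to nested unions.\<close>

lemma card_UN_le_sum:
  fixes b :: "'i \<Rightarrow> real"
  assumes "finite I" "\<And>i. i \<in> I \<Longrightarrow> finite (S i) \<and> real (card (S i)) \<le> b i"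
  shows "finite (\<Union>i\<in>I. S i) \<and> real (card (\<Union>i\<in>I. S i)) \<le> (\<Sum>i\<in>I. b i)"
proof
  show "finite (\<Union>i\<in>I. S i)" using assms by blast
  have "real (card (\<Union>i\<in>I. S i)) \<le> real (\<Sum>i\<in>I. card (S i))"
    using card_UN_le[OF assms(1), of S] of_nat_mono by blast
  also have "\<dots> \<le> (\<Sum>i\<in>I. b i)" unfolding of_nat_sum using assms(2) by (intro sum_mono) auto
  finally show "real (card (\<Union>i\<in>I. S i)) \<le> (\<Sum>i\<in>I. b i)" .
qed

section \<open>Bounded vectors of the dual of a lattice with triangular basis\<close>

definition triangular_dual :: "nat \<Rightarrow> nat \<Rightarrow> (nat \<Rightarrow> nat) \<Rightarrow> (nat \<Rightarrow> nat \<Rightarrow> int) \<Rightarrow> (nat \<Rightarrow> real) set" where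
  "triangular_dual C m d h = {t \<in> extensional {..<m}. \<forall>i<m. \<bar>t i\<bar> \<le> real C \<and>
     (\<Sum>j<i. t j * of_int (h i j)) + t i * real (d i) \<in> \<int>}"

text \<open>The conditions are solved from the top: once the \<open>t j\<close> with
  \<open>j < i\<close> are known, \<open>t i * d i\<close> is known modulo 1, so the integer part of
  \<open>d i * (t i + C)\<close> determines \<open>t i\<close>. It takes at most
  \<open>2 * C * d i + 1\<close> values.\<close>

lemma card_triangular_dual_le:
  assumes d: "\<And>i. i < m \<Longrightarrow> 0 < d i"
  shows "finite (triangular_dual C m d h)" (is "finite ?T")
    and "card (triangular_dual C m d h) \<le> (2 * C + 1) ^ m * (\<Prod>i<m. d i)"
proof -
  define f where "f t = (\<lambda>i\<in>{..<m}. \<lfloor>real (d i) * (t i + real C)\<rfloor>)" for t :: "nat \<Rightarrow> real"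
  let ?R = "PiE {..<m} (\<lambda>i. {0..2 * int C * int (d i)})"
  have inj: "inj_on f ?T"
  proof (rule inj_onI)
    fix t u assume t: "t \<in> ?T" and u: "u \<in> ?T" and eq: "f t = f u"
    have "t i = u i" if "i < m" for i
      using that
    proof (induction i rule: less_induct)
      case (less i)
      let ?st = "\<lambda>t. (\<Sum>j<i. t j * of_int (h i j)) + t i * real (d i)"
      have "?st t \<in> \<int>" "?st u \<in> \<int>" using t u less.prems unfolding triangular_dual_def by blast+
      then have "?st t - ?st u \<in> \<int>" by (rule Ints_diff)
      moreover have "(\<Sum>j<i. t j * of_int (h i j)) = (\<Sum>j<i. u j * of_int (h i j))"
        using less by (intro sum.cong) auto
      ultimately have "t i * real (d i) - u i * real (d i) \<in> \<int>" by simp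
      then obtain z where z: "t i * real (d i) - u i * real (d i) = of_int z" by (rule Ints_cases)
      have "\<lfloor>real (d i) * (t i + real C)\<rfloor> = \<lfloor>real (d i) * (u i + real C)\<rfloor>"
        using fun_cong[OF eq, of i] less.prems by (simp add: f_def)
      moreover have "real (d i) * (t i + real C) = real (d i) * (u i + real C) + of_int z"
        unfolding z[symmetric] by (simp add: algebra_simps)
      ultimately have "z = 0" by simp
      then show ?case using z d[OF less.prems] by (simp add: left_diff_distrib[symmetric])
    qed
    moreover have "t i = u i" if "\<not> i < m" for i
      using t u that by (auto simp: triangular_dual_def extensional_def)
    ultimately show "t = u" by blast
  qed
  have sub: "f ` ?T \<subseteq> ?R"
  proof (rule image_subsetI)
    fix t assume t: "t \<in> ?T"
    have "\<lfloor>real (d i) * (t i + real C)\<rfloor> \<in> {0..2 * int C * int (d i)}" if "i < m" for i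
    proof -
      have b: "\<bar>t i\<bar> \<le> real C" using t that by (auto simp: triangular_dual_def)
      have "real (d i) * (t i + real C) \<le> real (d i) * (2 * real C)"
        using b by (intro mult_left_mono) auto
      also have "\<dots> = of_int (2 * int C * int (d i))" by simp
      finally have "\<lfloor>real (d i) * (t i + real C)\<rfloor> \<le> 2 * int C * int (d i)"
        by (simp only: floor_le_iff)
      moreover have "0 \<le> real (d i) * (t i + real C)" using b by (intro mult_nonneg_nonneg) auto
      ultimately show ?thesis by simp
    qed
    then show "f t \<in> ?R" by (auto simp: f_def)
  qed
  have fin: "finite ?R" by (intro finite_PiE) auto
  show "finite ?T" using finite_imageD[OF finite_subset[OF sub fin] inj] .
  have "card ?T \<le> card ?R" using inj sub fin by (rule card_inj_on_le)
  also have "\<dots> = (\<Prod>i<m. nat (2 * int C * int (d i) + 1))" by (simp add: card_PiE)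
  also have "\<dots> \<le> (\<Prod>i<m. (2 * C + 1) * d i)"
  proof (rule prod_mono, intro conjI)
    fix i assume "i \<in> {..<m}"
    then have "0 < d i" using d by simp
    moreover have "nat (2 * int C * int (d i) + 1) = 2 * C * d i + 1"
      by (metis nat_int of_nat_1 of_nat_add of_nat_mult of_nat_numeral)
    ultimately show "nat (2 * int C * int (d i) + 1) \<le> (2 * C + 1) * d i" by simp
  qed simp
  also have "\<dots> = (2 * C + 1) ^ m * (\<Prod>i<m. d i)"
    by (simp only: prod.distrib prod_constant card_lessThan)
  finally show "card ?T \<le> (2 * C + 1) ^ m * (\<Prod>i<m. d i)" .
qed

section \<open>Elementary products and sums for the summation over diagonals\<close>

lemma prod_prod_lessThan:
  fixes f :: "nat \<Rightarrow> 'c::comm_monoid_mult"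
  shows "(\<Prod>i<m. \<Prod>j<i. f j) = (\<Prod>j<m. f j ^ (m - 1 - j))"
proof (induction m)
  case (Suc m)
  have "(\<Prod>j<m. f j ^ (m - 1 - j)) * (\<Prod>j<m. f j) = (\<Prod>j<m. f j ^ (m - j))"
    unfolding prod.distrib[symmetric]
    by (rule prod.cong) (auto simp: power_Suc2[symmetric] Suc_diff_Suc simp del: power_Suc)
  then show ?case using Suc by simp
qed simp

lemma sum_inverse_squares_le: "(\<Sum>q=1..N. 1 / (real q)\<^sup>2) \<le> 2"
proof -
  \<comment> \<open>The sharper bound makes the induction work, by telescoping.\<close>
  have "(\<Sum>q=1..N. 1 / (real q)\<^sup>2) \<le> 2 - 1 / real N" if "N > 0"
    using that
  proof (induction N rule: nat_induct_non_zero)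
    case (Suc N)
    have "1 / (real (Suc N))\<^sup>2 \<le> 1 / (real N * real (Suc N))"
      using Suc by (intro divide_left_mono) (auto simp: power2_eq_square intro!: mult_right_mono)
    also have "\<dots> = 1 / real N - 1 / real (Suc N)"
      using Suc by (simp add: field_simps)
    finally have "1 / (real (Suc N))\<^sup>2 \<le> 1 / real N - 1 / real (Suc N)" .
    then show ?case using Suc by simp
  qed simp
  moreover have "2 - 1 / real N \<le> 2" by simp
  ultimately show ?thesis by (cases "N > 0") (blast intro: order_trans, simp)
qed

lemma harm_le: "0 < N \<Longrightarrow> (\<Sum>q=1..N. 1 / real q) \<le> 1 + ln (real N)"
proof (induction N rule: nat_induct_non_zero)
  case (Suc N)
  have "ln (real N / real (Suc N)) \<le> real N / real (Suc N) - 1"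
    using Suc by (intro ln_le_minus_one) simp
  then have "1 / real (Suc N) \<le> ln (real (Suc N)) - ln (real N)"
    using Suc by (simp add: ln_div field_simps)
  then show ?case using Suc by simp
qed simp


section \<open>Matrices with prescribed linear dependences among the rows\<close>

definition dual_lattice :: "nat \<Rightarrow> 'a set \<Rightarrow> ('a \<Rightarrow> nat \<Rightarrow> real) \<Rightarrow> (nat \<Rightarrow> int) set" where
  "dual_lattice m L \<Theta> = {x. (\<forall>i\<ge>m. x i = 0) \<and> (\<forall>l\<in>L. (\<Sum>i<m. \<Theta> l i * of_int (x i)) \<in> \<int>)}"

text \<open>The first condition does not involve \<open>X\<close>. It empties the set unless the
  lattice has at most \<open>P / D\<close> points in the box, so that the count below holds for all
  parameters, even those for which \<open>D\<close> is not the product of a lattice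
  diagonal.\<close>

definition row_dependent ::
  "nat \<Rightarrow> nat \<Rightarrow> nat \<Rightarrow> (nat \<Rightarrow> 'a) \<Rightarrow> ('a \<Rightarrow> nat \<Rightarrow> real) \<Rightarrow> nat \<Rightarrow> ('a \<Rightarrow> 'b \<Rightarrow> int) set" where
  "row_dependent P n m e \<Theta> D = {X.
     D * card (dual_lattice m (- e ` {..<m}) \<Theta> \<inter> vecs m (\<lambda>_. {- int n..int n})) \<le> P \<and>
     (\<forall>l\<in>- e ` {..<m}. \<forall>j. of_int (X l j) = (\<Sum>i<m. \<Theta> l i * of_int (X (e i) j))) \<and>
     (\<forall>j. (\<lambda>i. if i < m then X (e i) j else 0) \<in>
        dual_lattice m (- e ` {..<m}) \<Theta> \<inter> vecs m (\<lambda>_. {- int n..int n}))}"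

text \<open>A matrix in the set is determined by its columns cut down to the rows
  \<open>e i\<close>. Each of them is one of at most \<open>P / D\<close> lattice points.\<close>

lemma card_row_dependent_le:
  fixes e :: "nat \<Rightarrow> 'a::finite"
  assumes D: "0 < D"
  shows "finite (row_dependent P n m e \<Theta> D :: ('a \<Rightarrow> 'b::finite \<Rightarrow> int) set) \<and>
    real (card (row_dependent P n m e \<Theta> D :: ('a \<Rightarrow> 'b \<Rightarrow> int) set)) \<le> (real P / real D) ^ CARD('b)"
proof -
  let ?S = "row_dependent P n m e \<Theta> D :: ('a \<Rightarrow> 'b \<Rightarrow> int) set"
  let ?L = "dual_lattice m (- e ` {..<m}) \<Theta> \<inter> vecs m (\<lambda>_. {- int n..int n})"
  define f where "f X j i = (if i < m then X (e i) j else 0)" for X :: "'a \<Rightarrow> 'b \<Rightarrow> int" and j i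
  have inj: "inj_on f ?S"
  proof (rule inj_onI)
    fix X Y assume X: "X \<in> ?S" and Y: "Y \<in> ?S" and eq: "f X = f Y"
    have base: "X (e i) j = Y (e i) j" if "i < m" for i j
      using fun_cong[OF fun_cong[OF eq, of j], of i] that by (simp add: f_def)
    have "X l j = Y l j" for l j
    proof (cases "l \<in> e ` {..<m}")
      case True
      then show ?thesis using base by auto
    next
      case False
      then have l: "l \<in> - e ` {..<m}" by simp
      have "real_of_int (X l j) = (\<Sum>i<m. \<Theta> l i * of_int (X (e i) j))"
        using X l unfolding row_dependent_def by blast
      also have "\<dots> = (\<Sum>i<m. \<Theta> l i * of_int (Y (e i) j))"
        using base by (intro sum.cong) auto
      also have "\<dots> = real_of_int (Y l j)"
        using Y l unfolding row_dependent_def by simp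
      finally show ?thesis by simp
    qed
    then show "X = Y" by blast
  qed
  have sub: "f ` ?S \<subseteq> PiE UNIV (\<lambda>_. ?L)"
  proof (rule image_subsetI)
    fix X assume "X \<in> ?S"
    then have "\<forall>j. (\<lambda>i. if i < m then X (e i) j else 0) \<in> ?L" unfolding row_dependent_def by blast
    then show "f X \<in> PiE UNIV (\<lambda>_. ?L)" by (simp add: f_def[abs_def] PiE_UNIV_domain)
  qed
  have "finite (vecs m (\<lambda>_. {- int n..int n}))" by (rule finite_vecs) simp
  then have fin: "finite (PiE (UNIV :: 'b set) (\<lambda>_. ?L))" by (intro finite_PiE) auto
  have 1: "finite ?S" using finite_imageD[OF finite_subset[OF sub fin] inj] .
  have "card ?S \<le> card (PiE (UNIV :: 'b set) (\<lambda>_. ?L))" using inj sub fin by (rule card_inj_on_le)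
  then have le: "card ?S \<le> card ?L ^ CARD('b)" by (simp add: card_PiE)
  have "real (card ?S) \<le> (real P / real D) ^ CARD('b)"
  proof (cases "D * card ?L \<le> P")
    case True
    then have "real D * real (card ?L) \<le> real P" by (metis of_nat_mono of_nat_mult)
    then have "real (card ?L) \<le> real P / real D" using D by (simp add: field_simps)
    then have "real (card ?L) ^ CARD('b) \<le> (real P / real D) ^ CARD('b)" by (intro power_mono) auto
    moreover have "real (card ?S) \<le> real (card ?L) ^ CARD('b)" using le by (metis of_nat_mono of_nat_power)
    ultimately show ?thesis by linarith
  next
    case False
    then have "?S = {}" unfolding row_dependent_def by blast
    then show ?thesis by simp
  qed
  with 1 show ?thesis ..
qed

text \<open>The cut-down columns lie in the lattice, since \<Theta> maps them to entries of
  \<open>X\<close>. Write \<open>v\<close> as a real combination of them and round the coefficients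
  down: the result \<open>y\<close> stays in the lattice, and \<open>v - y\<close> is a combination
  with coefficients in [0, 1) of \<open>CARD('b)\<close> columns of size at most
  \<open>n\<close>.\<close>

lemma covering_lattice_dual:
  fixes X :: "'a \<Rightarrow> 'b::finite \<Rightarrow> int"
  assumes X: "\<And>l j. \<bar>X l j\<bar> \<le> int n"
    and dep: "\<And>l j. l \<in> L \<Longrightarrow> of_int (X l j) = (\<Sum>i<m. \<Theta> l i * of_int (X (e i) j))"
    and span: "\<And>c. \<exists>s. \<forall>i<m. (\<Sum>j\<in>UNIV. s j * of_int (X (e i) j)) = (c i :: real)"
  shows "covering_lattice (dual_lattice m L \<Theta>) m (CARD('b) * n)"
proof
  show "(\<lambda>_. 0) \<in> dual_lattice m L \<Theta>" by (simp add: dual_lattice_def)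
  show "x i = 0" if "x \<in> dual_lattice m L \<Theta>" "m \<le> i" for x i
    using that by (simp add: dual_lattice_def)
  show comb: "(\<lambda>i. x i - c * y i) \<in> dual_lattice m L \<Theta>"
    if "x \<in> dual_lattice m L \<Theta>" "y \<in> dual_lattice m L \<Theta>" for x y c
  proof -
    have "(\<Sum>i<m. \<Theta> l i * of_int (x i - c * y i)) \<in> \<int>" if "l \<in> L" for l
    proof -
      have "(\<Sum>i<m. \<Theta> l i * of_int (x i - c * y i))
          = (\<Sum>i<m. \<Theta> l i * of_int (x i)) - of_int c * (\<Sum>i<m. \<Theta> l i * of_int (y i))"
        by (simp add: algebra_simps sum_subtractf sum_distrib_left)
      also have "\<dots> \<in> \<int>" using that \<open>x \<in> _\<close> \<open>y \<in> _\<close> by (intro Ints_diff Ints_mult) (auto simp: dual_lattice_def)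
      finally show ?thesis .
    qed
    then show ?thesis using that by (simp add: dual_lattice_def)
  qed
  fix v :: "nat \<Rightarrow> int" assume v: "v \<in> vecs m (\<lambda>_. UNIV)"
  obtain s where s: "\<And>i. i < m \<Longrightarrow> (\<Sum>j\<in>UNIV. s j * of_int (X (e i) j)) = real_of_int (v i)"
    using span[of "\<lambda>i. of_int (v i)"] by blast
  define y where "y i = (if i < m then \<Sum>j\<in>UNIV. \<lfloor>s j\<rfloor> * X (e i) j else 0)" for i
  have "(\<Sum>i<m. \<Theta> l i * of_int (y i)) \<in> \<int>" if "l \<in> L" for l
  proof -
    have "(\<Sum>i<m. \<Theta> l i * of_int (y i)) = (\<Sum>i<m. \<Sum>j\<in>UNIV. \<Theta> l i * (of_int \<lfloor>s j\<rfloor> * of_int (X (e i) j)))"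
      by (simp add: y_def sum_distrib_left)
    also have "\<dots> = (\<Sum>j\<in>UNIV. of_int \<lfloor>s j\<rfloor> * (\<Sum>i<m. \<Theta> l i * of_int (X (e i) j)))"
      by (subst sum.swap) (simp add: sum_distrib_left mult.left_commute)
    also have "\<dots> = (\<Sum>j\<in>UNIV. of_int (\<lfloor>s j\<rfloor> * X l j))" using dep[OF that] by simp
    also have "\<dots> \<in> \<int>" by (intro Ints_sum Ints_of_int)
    finally show ?thesis .
  qed
  then have "y \<in> dual_lattice m L \<Theta>" by (simp add: dual_lattice_def y_def)
  moreover have "(\<lambda>i. v i - y i) \<in> vecs m (\<lambda>_. {- int (CARD('b) * n)..int (CARD('b) * n)})"
  proof -
    have "\<bar>v i - y i\<bar> \<le> int (CARD('b) * n)" if i: "i < m" for i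
    proof -
      have "real_of_int (v i - y i) = (\<Sum>j\<in>UNIV. frac (s j) * of_int (X (e i) j))"
        using s[OF i] i by (simp add: y_def frac_def left_diff_distrib sum_subtractf)
      also have "\<bar>\<dots>\<bar> \<le> (\<Sum>j\<in>(UNIV::'b set). real n)"
      proof (rule order_trans[OF sum_abs], rule sum_mono)
        fix j
        have "\<bar>real_of_int (X (e i) j)\<bar> \<le> real n" using X[of "e i" j] by linarith
        moreover have "\<bar>frac (s j)\<bar> \<le> 1" using frac_ge_0[of "s j"] frac_lt_1[of "s j"] by linarith
        ultimately have "\<bar>frac (s j)\<bar> * \<bar>real_of_int (X (e i) j)\<bar> \<le> 1 * real n"
          by (intro mult_mono) auto
        then show "\<bar>frac (s j) * real_of_int (X (e i) j)\<bar> \<le> real n" by (simp add: abs_mult)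
      qed
      finally have "\<bar>real_of_int (v i - y i)\<bar> \<le> real (CARD('b) * n)" by simp
      then show ?thesis by linarith
    qed
    then show ?thesis using v by (force simp: vecs_def y_def abs_le_iff)
  qed
  ultimately show "\<exists>y\<in>dual_lattice m L \<Theta>. (\<lambda>i. v i - y i) \<in> vecs m (\<lambda>_. {- int (CARD('b) * n)..int (CARD('b) * n)})"
    by blast
qed

text \<open>Covers the low rank matrices by the families counted above: \<open>e\<close> selects the
  basis rows, \<open>d\<close> and \<open>h\<close> are the diagonal and the lower part of a reduced
  triangular basis of the lattice, and \<Theta> holds the coefficients of the other rows. All
  parameters range over finite sets that depend only on \<open>n\<close>, \<open>k\<close>, the
  index types and earlier parameters.\<close>

lemma low_rank_row_dependent:
  fixes X :: "'a::finite \<Rightarrow> 'b::finite \<Rightarrow> int"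
  assumes X: "\<And>l j. X l j \<in> {1..int n}"
    and rank: "rank (\<chi> l j. real_of_int (X l j)) \<le> k"
    and P: "\<And>m. P m = (2 * (CARD('b) * n + n) + 1) ^ m"
  shows "\<exists>m\<le>k. \<exists>e\<in>{e \<in> PiE {..<m} (\<lambda>_. UNIV). inj_on e {..<m}}. \<exists>d\<in>PiE {..<m} (\<lambda>_. {1..P m}).
    \<exists>h\<in>PiE {..<m} (\<lambda>i. PiE {..<i} (\<lambda>j. {0..<int (d j)})).
    \<exists>\<Theta>\<in>PiE (- e ` {..<m}) (\<lambda>_. triangular_dual (2 ^ k) m d h).
      X \<in> row_dependent (P m) n m e \<Theta> (\<Prod>i<m. d i)"
proof -
  obtain m e0 where
    row: "\<And>l. \<exists>t. (\<Sum>i<m. \<bar>t i\<bar>) \<le> 2 ^ m - 1 \<and>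
        (\<forall>j. real_of_int (X l j) = (\<Sum>i<m. t i * real_of_int (X (e0 i) j)))"
    and span0: "\<And>c. \<exists>s. \<forall>i<m. (\<Sum>j\<in>UNIV. s j * real_of_int (X (e0 i) j)) = c i"
    using bounded_row_basis[of "\<lambda>l j. real_of_int (X l j)"] by blast
  define e where "e = restrict e0 {..<m}"
  have span: "\<exists>s. \<forall>i<m. (\<Sum>j\<in>UNIV. s j * real_of_int (X (e i) j)) = c i" for c
    using span0[of c] by (simp add: e_def)
  have inj: "inj_on e {..<m}" and "m \<le> rank (\<chi> l j. real_of_int (X l j))"
    using le_rank_if_rows_span[of m "\<chi> l j. real_of_int (X l j)" e] span by simp_all
  with rank have mk: "m \<le> k" by simp
  obtain T where T: "\<And>l. (\<Sum>i<m. \<bar>T l i\<bar>) \<le> 2 ^ m - 1"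
    "\<And>l j. real_of_int (X l j) = (\<Sum>i<m. T l i * real_of_int (X (e0 i) j))"
    using row by metis
  let ?L = "- e ` {..<m}"
  define \<Theta> where "\<Theta> = (\<lambda>l\<in>?L. restrict (T l) {..<m})"
  have dep: "of_int (X l j) = (\<Sum>i<m. \<Theta> l i * of_int (X (e i) j))" if "l \<in> ?L" for l j
    using T(2)[of l j] that by (simp add: \<Theta>_def e_def)
  have small: "\<bar>X l j\<bar> \<le> int n" for l j using X[of l j] by simp
  interpret covering_lattice "dual_lattice m ?L \<Theta>" m "CARD('b) * n"
    using small dep span by (rule covering_lattice_dual)
  have card: "(\<Prod>i<m. pivot i) * card (dual_lattice m ?L \<Theta> \<inter> vecs m (\<lambda>_. {- int n..int n})) \<le> P m"
    unfolding P by (rule prod_pivot_mult_card_le)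
  define d where "d = restrict pivot {..<m}"
  have pos: "0 < pivot i" if "i < m" for i using lead_pivot[OF that] by (simp add: lead_def)
  have "\<forall>i. \<exists>x. i < m \<longrightarrow> x \<in> dual_lattice m ?L \<Theta> \<and> x i = int (pivot i) \<and> (\<forall>j>i. x j = 0)
      \<and> (\<forall>j<i. x j \<in> {0..<int (pivot j)})"
    using reduced_row by blast
  then obtain h0 where h0: "\<And>i. i < m \<Longrightarrow> h0 i \<in> dual_lattice m ?L \<Theta>"
    "\<And>i. i < m \<Longrightarrow> h0 i i = int (pivot i)" "\<And>i j. i < m \<Longrightarrow> i < j \<Longrightarrow> h0 i j = 0"
    "\<And>i j. i < m \<Longrightarrow> j < i \<Longrightarrow> h0 i j \<in> {0..<int (pivot j)}" by metis
  define h where "h = (\<lambda>i\<in>{..<m}. restrict (h0 i) {..<i})"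
  have "d \<in> PiE {..<m} (\<lambda>_. {1..P m})"
  proof -
    \<comment> \<open>The zero vector is always counted, so the product of the pivots alone is at
      most \<open>P m\<close>.\<close>
    have "pivot i \<le> P m" if "i < m" for i
    proof -
      let ?N = "dual_lattice m ?L \<Theta> \<inter> vecs m (\<lambda>_. {- int n..int n})"
      have "(\<lambda>_. 0) \<in> ?N" using zero by (simp add: vecs_def)
      moreover have "finite ?N" by (intro finite_Int disjI2 finite_vecs) simp
      ultimately have "0 < card ?N" by (auto simp: card_gt_0_iff)
      moreover have "pivot i \<le> (\<Prod>i<m. pivot i)"
        using that pos by (intro dvd_imp_le prod_pos) (auto intro: dvd_prodI)
      ultimately have "pivot i * 1 \<le> (\<Prod>i<m. pivot i) * card ?N" by (intro mult_le_mono) auto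
      then show ?thesis using card by simp
    qed
    then show ?thesis using pos by (force simp: d_def Suc_le_eq)
  qed
  moreover have "h \<in> PiE {..<m} (\<lambda>i. PiE {..<i} (\<lambda>j. {0..<int (d j)}))"
    using h0(4) by (auto simp: h_def d_def)
  moreover have "\<Theta> \<in> PiE ?L (\<lambda>_. triangular_dual (2 ^ k) m d h)"
  proof -
    have "restrict (T l) {..<m} \<in> triangular_dual (2 ^ k) m d h" if l: "l \<in> ?L" for l
    proof -
      have "\<bar>T l i\<bar> \<le> 2 ^ k" if i: "i < m" for i
      proof -
        have "\<bar>T l i\<bar> \<le> (\<Sum>i<m. \<bar>T l i\<bar>)" using i by (intro member_le_sum) auto
        also have "\<dots> \<le> 2 ^ m" using T(1)[of l] by simp
        also have "\<dots> \<le> 2 ^ k" using mk by simp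
        finally show ?thesis .
      qed
      \<comment> \<open>This is integrality of \<Theta> on the basis vector \<open>h0 i\<close>,
        whose coordinates after \<open>i\<close> vanish.\<close>
      moreover have "(\<Sum>j<i. T l j * of_int (h i j)) + T l i * real (d i) \<in> \<int>" if i: "i < m" for i
      proof -
        have "(\<Sum>j<m. \<Theta> l j * of_int (h0 i j)) \<in> \<int>"
          using h0(1)[OF i] l by (simp add: dual_lattice_def)
        also have "(\<Sum>j<m. \<Theta> l j * of_int (h0 i j)) = (\<Sum>j<m. T l j * of_int (h0 i j))"
          using l by (simp add: \<Theta>_def)
        also have "\<dots> = (\<Sum>j<Suc i. T l j * of_int (h0 i j))"
          using i h0(3)[OF i] by (intro sum.mono_neutral_right) auto
        also have "\<dots> = (\<Sum>j<i. T l j * of_int (h i j)) + T l i * real (d i)"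
          using i h0(2)[OF i] by (simp add: h_def d_def)
        finally show ?thesis .
      qed
      ultimately show ?thesis by (simp add: triangular_dual_def)
    qed
    then show ?thesis by (simp add: \<Theta>_def)
  qed
  moreover have "X \<in> row_dependent (P m) n m e \<Theta> (\<Prod>i<m. d i)"
  proof -
    have "(\<lambda>i. if i < m then X (e i) j else 0) \<in> dual_lattice m ?L \<Theta> \<inter> vecs m (\<lambda>_. {- int n..int n})" for j
    proof -
      have "(\<Sum>i<m. \<Theta> l i * of_int (if i < m then X (e i) j else 0)) \<in> \<int>" if "l \<in> ?L" for l
        using Ints_of_int[of "X l j", where 'a = real] unfolding dep[OF that] by simp
      moreover have "- int n \<le> X (e i) j" "X (e i) j \<le> int n" for i
        using small[of "e i" j] by linarith+
      ultimately show ?thesis by (simp add: dual_lattice_def vecs_def)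
    qed
    then show ?thesis using card dep by (simp add: row_dependent_def d_def)
  qed
  moreover have "e \<in> {e \<in> PiE {..<m} (\<lambda>_. UNIV). inj_on e {..<m}}" using inj by (simp add: e_def)
  ultimately show ?thesis using mk by blast
qed

text \<open>With \<open>a = CARD('a)\<close> and \<open>b = CARD('b)\<close>, the exponent of
  \<open>d j\<close> is \<open>m - 1 - j\<close> from the choice of \<open>h\<close>,
  \<open>a - m\<close> from \<Theta> and \<open>- b\<close> from the matrices, in total
  \<open>a - b - 1 - j\<close>. As \<open>a \<le> b\<close>, this is at most -2, except for -1 when
  \<open>j = 0\<close> and \<open>a = b\<close>.\<close>

lemma card_row_dependent_family_le:
  fixes e :: "nat \<Rightarrow> 'a::finite" and C n P :: nat
  assumes e: "inj_on e {..<m}" "m \<le> CARD('a)" and le: "CARD('a) \<le> CARD('b::finite)"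
    and d: "\<And>i. i < m \<Longrightarrow> 0 < d i"
  defines "S \<equiv> \<lambda>h. \<Union>\<Theta>\<in>PiE (- e ` {..<m}) (\<lambda>_. triangular_dual C m d h).
     (row_dependent P n m e \<Theta> (\<Prod>i<m. d i) :: ('a \<Rightarrow> 'b \<Rightarrow> int) set)"
    and "H \<equiv> PiE {..<m} (\<lambda>i. PiE {..<i} (\<lambda>j. {0..<int (d j)}))"
  shows "finite (\<Union>h\<in>H. S h) \<and> real (card (\<Union>h\<in>H. S h)) \<le>
    (2 * C + 1) ^ (m * (CARD('a) - m)) * real P ^ CARD('b) *
      (\<Prod>j<m. 1 / real (d j) ^ (if j = 0 \<and> CARD('a) = CARD('b) then 1 else 2))"
proof -
  define D where "D = (\<Prod>i<m. d i)"
  have D: "0 < D" unfolding D_def using d by (intro prod_pos) auto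
  let ?b = "real ((2 * C + 1) ^ m * D) ^ (CARD('a) - m) * (real P / real D) ^ CARD('b)"
  have S: "finite (S h) \<and> real (card (S h)) \<le> ?b" for h
  proof -
    let ?T = "PiE (- e ` {..<m}) (\<lambda>_. triangular_dual C m d h)"
    have fin: "finite ?T" by (intro finite_PiE card_triangular_dual_le d) auto
    have "finite (S h) \<and> real (card (S h)) \<le> (\<Sum>\<Theta>\<in>?T. (real P / real D) ^ CARD('b))"
      unfolding S_def D_def[symmetric] using fin card_row_dependent_le[OF D] by (rule card_UN_le_sum)
    moreover have "card ?T \<le> ((2 * C + 1) ^ m * D) ^ (CARD('a) - m)"
    proof -
      have "card (- e ` {..<m}) = CARD('a) - m"
        using e(1) by (simp add: Compl_eq_Diff_UNIV card_Diff_subset card_image)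
      then have "card ?T = card (triangular_dual C m d h) ^ (CARD('a) - m)" by (simp add: card_PiE)
      also have "\<dots> \<le> ((2 * C + 1) ^ m * D) ^ (CARD('a) - m)"
        unfolding D_def using d by (intro power_mono card_triangular_dual_le) auto
      finally show ?thesis .
    qed
    then have "real (card ?T) * (real P / real D) ^ CARD('b) \<le> ?b"
      by (intro mult_right_mono) (metis of_nat_mono of_nat_power, simp)
    ultimately show ?thesis by simp
  qed
  have finH: "finite H" unfolding H_def by (intro finite_PiE) auto
  \<comment> \<open>Column \<open>j\<close> has \<open>m - 1 - j\<close> entries below the diagonal,
    each with \<open>d j\<close> choices.\<close>
  have cardH: "card H = (\<Prod>j<m. d j ^ (m - 1 - j))"
    unfolding H_def prod_prod_lessThan[symmetric] by (simp add: card_PiE)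
  have "finite (\<Union>h\<in>H. S h) \<and> real (card (\<Union>h\<in>H. S h)) \<le> (\<Sum>h\<in>H. ?b)"
    using finH S by (rule card_UN_le_sum)
  moreover have "(\<Sum>h\<in>H. ?b) \<le> (2 * C + 1) ^ (m * (CARD('a) - m)) * real P ^ CARD('b) *
      (\<Prod>j<m. 1 / real (d j) ^ (if j = 0 \<and> CARD('a) = CARD('b) then 1 else 2))"
  proof -
    have "(\<Sum>h\<in>H. ?b) = (\<Prod>j<m. real (d j) ^ (m - 1 - j)) * ?b" by (simp add: cardH)
    also have "\<dots> = (2 * C + 1) ^ (m * (CARD('a) - m)) * real P ^ CARD('b) *
      ((\<Prod>j<m. real (d j) ^ (m - 1 - j)) * (real D ^ (CARD('a) - m) / real D ^ CARD('b)))"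
      by (simp add: power_mult_distrib power_mult power_divide)
    also have "(\<Prod>j<m. real (d j) ^ (m - 1 - j)) * (real D ^ (CARD('a) - m) / real D ^ CARD('b))
      = (\<Prod>j<m. real (d j) ^ (m - 1 - j) * (real (d j) ^ (CARD('a) - m) / real (d j) ^ CARD('b)))"
      by (simp add: D_def prod.distrib prod_dividef prod_power_distrib)
    also have "\<dots> \<le> (\<Prod>j<m. 1 / real (d j) ^ (if j = 0 \<and> CARD('a) = CARD('b) then 1 else 2))"
    proof (rule prod_mono, intro conjI)
      fix j assume "j \<in> {..<m}"
      then have j: "j < m" by simp
      let ?s = "if j = 0 \<and> CARD('a) = CARD('b) then 1 else 2 :: nat"
      let ?q = "real (d j)"
      have q: "1 \<le> ?q" using d[OF j] by simp
      have "(m - 1 - j) + (CARD('a) - m) + ?s \<le> CARD('b)"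
        using e(2) le j by (auto split: if_splits)
      with q have "?q ^ ((m - 1 - j) + (CARD('a) - m) + ?s) \<le> ?q ^ CARD('b)"
        by (intro power_increasing)
      then show "?q ^ (m - 1 - j) * (?q ^ (CARD('a) - m) / ?q ^ CARD('b)) \<le> 1 / ?q ^ ?s"
        using q by (simp only: power_add) (simp add: field_simps)
    qed simp
    finally show ?thesis by (simp add: mult_left_mono)
  qed
  ultimately show ?thesis by linarith
qed

text \<open>After summing over \<open>d\<close>, the product over \<open>j\<close> becomes a product
  of sums. All are bounded by 2, except that in the square case the sum for \<open>j = 0\<close> is
  harmonic and is bounded by \<open>G\<close>.\<close>

lemma card_low_rank_le:
  fixes n k :: nat and G :: real
  assumes le: "CARD('a::finite) \<le> CARD('b::finite)" and k: "k \<le> CARD('a)"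
    and B: "B = 2 * (CARD('b) * n + n) + 1"
    and G: "1 \<le> G" "(\<Sum>q=1..B ^ k. 1 / real q ^ (if CARD('a) = CARD('b) then 1 else 2)) \<le> G"
  shows "real (card (low_rank n k :: ('a \<Rightarrow> 'b \<Rightarrow> int) set))
    \<le> (\<Sum>m\<le>k. real (CARD('a) ^ m * (2 * 2 ^ k + 1) ^ (m * (CARD('a) - m)) * 2 ^ m)) * real B ^ (k * CARD('b)) * G"
proof -
  let ?X = "{X :: 'a \<Rightarrow> 'b \<Rightarrow> int. (\<forall>l j. X l j \<in> {1..int n}) \<and> rank (\<chi> l j. real_of_int (X l j)) \<le> k}"
  let ?E = "\<lambda>m. {e \<in> PiE {..<m} (\<lambda>_. UNIV). inj_on e {..<m}} :: (nat \<Rightarrow> 'a) set"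
  let ?D = "\<lambda>m. PiE {..<m} (\<lambda>_. {1..B ^ m})"
  let ?C = "2 ^ k :: nat"
  define F where "F m e d = (\<Union>h\<in>PiE {..<m} (\<lambda>i. PiE {..<i} (\<lambda>j. {0..<int (d j)})).
      \<Union>\<Theta>\<in>PiE (- e ` {..<m}) (\<lambda>_. triangular_dual ?C m d h).
      (row_dependent (B ^ m) n m e \<Theta> (\<Prod>i<m. d i) :: ('a \<Rightarrow> 'b \<Rightarrow> int) set))" for m e d
  define s :: "nat \<Rightarrow> nat" where "s j = (if j = 0 \<and> CARD('a) = CARD('b) then 1 else 2)" for j
  define c where "c m = real ((2 * ?C + 1) ^ (m * (CARD('a) - m))) * real (B ^ m) ^ CARD('b)" for m
  have F: "finite (F m e d) \<and> real (card (F m e d)) \<le> c m * (\<Prod>j<m. 1 / real (d j) ^ s j)"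
    if "m \<le> k" "e \<in> ?E m" "d \<in> ?D m" for m e d
  proof -
    have "0 < d i" if "i < m" for i using \<open>d \<in> ?D m\<close> that by (force simp: PiE_iff)
    then show ?thesis
      unfolding F_def c_def s_def using that k le
      by (intro card_row_dependent_family_le) auto
  qed
  have finE: "finite (?E m)" for m by (rule finite_subset[of _ "PiE {..<m} (\<lambda>_. UNIV)"]) (auto intro: finite_PiE)
  have cardE: "card (?E m) \<le> CARD('a) ^ m" for m
    using card_mono[of "PiE {..<m} (\<lambda>_. UNIV :: 'a set)" "?E m"] by (auto simp: card_PiE finite_PiE)
  have finD: "finite (?D m)" for m by (intro finite_PiE) auto
  have "?X \<subseteq> (\<Union>m\<in>{..k}. \<Union>e\<in>?E m. \<Union>d\<in>?D m. F m e d)"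
  proof
    fix X :: "'a \<Rightarrow> 'b \<Rightarrow> int" assume "X \<in> ?X"
    then have "\<And>l j. X l j \<in> {1..int n}" "rank (\<chi> l j. real_of_int (X l j)) \<le> k" by blast+
    from low_rank_row_dependent[OF this, of "\<lambda>m. B ^ m"] B
    show "X \<in> (\<Union>m\<in>{..k}. \<Union>e\<in>?E m. \<Union>d\<in>?D m. F m e d)"
      unfolding F_def UN_iff atMost_iff Bex_def by meson
  qed
  moreover have "finite (\<Union>m\<in>{..k}. \<Union>e\<in>?E m. \<Union>d\<in>?D m. F m e d) \<and>
    real (card (\<Union>m\<in>{..k}. \<Union>e\<in>?E m. \<Union>d\<in>?D m. F m e d)) \<le>
    (\<Sum>m\<in>{..k}. \<Sum>e\<in>?E m. \<Sum>d\<in>?D m. c m * (\<Prod>j<m. 1 / real (d j) ^ s j))"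
    by (intro card_UN_le_sum finE finD F) auto
  ultimately have "real (card ?X) \<le> (\<Sum>m\<in>{..k}. \<Sum>e\<in>?E m. \<Sum>d\<in>?D m. c m * (\<Prod>j<m. 1 / real (d j) ^ s j))"
    by (meson card_mono of_nat_mono order_trans)
  also have "\<dots> \<le> (\<Sum>m\<in>{..k}. real (CARD('a) ^ m * (2 * 2 ^ k + 1) ^ (m * (CARD('a) - m)) * 2 ^ m) * (real B ^ (k * CARD('b)) * G))"
  proof (rule sum_mono)
    fix m assume "m \<in> {..k}"
    then have m: "m \<le> k" by simp
    have B1: "1 \<le> B" using B by simp
    have "(\<Sum>d\<in>?D m. \<Prod>j<m. 1 / real (d j) ^ s j) = (\<Prod>j<m. \<Sum>q=1..B ^ m. 1 / real q ^ s j)"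
      by (rule prod_sum_PiE[symmetric]) auto
    also have "\<dots> \<le> (\<Prod>j<m. 2 * (if j = 0 then G else 1))"
    proof (rule prod_mono, intro conjI)
      fix j
      \<comment> \<open>Extending the range to \<open>B ^ k\<close> lets one \<open>G\<close> serve
        for all \<open>m \<le> k\<close>.\<close>
      have mono: "(\<Sum>q=1..B ^ m. 1 / real q ^ i) \<le> (\<Sum>q=1..B ^ k. 1 / real q ^ i)" for i
        using m B1 by (intro sum_mono2) (auto simp: power_increasing intro: order_trans)
      show "(\<Sum>q=1..B ^ m. 1 / real q ^ s j) \<le> 2 * (if j = 0 then G else 1)"
      proof (cases "j = 0 \<and> CARD('a) = CARD('b)")
        case True
        then show ?thesis using mono[of 1] G by (simp add: s_def)
      next
        case False
        then have "s j = 2" by (simp add: s_def)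
        then have "(\<Sum>q=1..B ^ m. 1 / real q ^ s j) \<le> 2" using sum_inverse_squares_le[of "B ^ m"] by simp
        then show ?thesis using G(1) by (auto intro: order_trans)
      qed
    qed (simp add: sum_nonneg)
    also have "\<dots> = 2 ^ m * (\<Prod>j<m. if j = 0 then G else 1)" by (simp add: prod.distrib)
    also have "(\<Prod>j<m. if j = 0 then G else 1) \<le> G"
      using G(1) by (cases "0 < m") (simp_all add: prod.delta)
    finally have sumd: "(\<Sum>d\<in>?D m. \<Prod>j<m. 1 / real (d j) ^ s j) \<le> 2 ^ m * G" by simp
    have "(\<Sum>e\<in>?E m. \<Sum>d\<in>?D m. c m * (\<Prod>j<m. 1 / real (d j) ^ s j))
      = real (card (?E m)) * (c m * (\<Sum>d\<in>?D m. \<Prod>j<m. 1 / real (d j) ^ s j))"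
      by (simp add: sum_distrib_left)
    also have "\<dots> \<le> real (CARD('a) ^ m) * (c m * (2 ^ m * G))"
      using cardE[of m] sumd G(1)
      by (intro mult_mono mult_left_mono) (auto simp: c_def sum_nonneg prod_nonneg simp flip: of_nat_power)
    also have "c m \<le> real ((2 * ?C + 1) ^ (m * (CARD('a) - m))) * real B ^ (k * CARD('b))"
    proof -
      have "real (B ^ m) ^ CARD('b) = real B ^ (m * CARD('b))" by (simp add: power_mult)
      also have "\<dots> \<le> real B ^ (k * CARD('b))" using B1 m by (intro power_increasing) auto
      finally show ?thesis unfolding c_def by (intro mult_left_mono) auto
    qed
    finally show "(\<Sum>e\<in>?E m. \<Sum>d\<in>?D m. c m * (\<Prod>j<m. 1 / real (d j) ^ s j)) \<le>
      real (CARD('a) ^ m * (2 * 2 ^ k + 1) ^ (m * (CARD('a) - m)) * 2 ^ m) * (real B ^ (k * CARD('b)) * G)"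
      using G(1) by (simp add: mult_ac mult_left_mono mult_right_mono)
  qed
  finally show ?thesis by (simp add: low_rank_def sum_distrib_right mult.assoc)
qed

section \<open>Lower bound for the number of matrices\<close>

text \<open>At an index \<open>i\<close> where the modulus of \<delta> is maximal, the
  \<open>i\<close>-th equation contradicts dominance unless \<open>\<delta> i = 0\<close>.\<close>

lemma diagonally_dominant_kernel:
  fixes x :: "nat \<Rightarrow> nat \<Rightarrow> real"
  assumes dom: "\<And>i. i < k \<Longrightarrow> (\<Sum>c\<in>{..<k} - {i}. \<bar>x i c\<bar>) < \<bar>x i i\<bar>"
    and ker: "\<And>i. i < k \<Longrightarrow> (\<Sum>c<k. \<delta> c * x i c) = 0"
    and c: "c < k"
  shows "\<delta> c = 0"
proof -
  have "Max ((\<lambda>c. \<bar>\<delta> c\<bar>) ` {..<k}) \<in> (\<lambda>c. \<bar>\<delta> c\<bar>) ` {..<k}" using c by (intro Max_in) auto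
  then obtain i where i: "i < k" "Max ((\<lambda>c. \<bar>\<delta> c\<bar>) ` {..<k}) = \<bar>\<delta> i\<bar>" by auto
  have max: "\<bar>\<delta> c\<bar> \<le> \<bar>\<delta> i\<bar>" if "c < k" for c unfolding i(2)[symmetric] using that by (intro Max_ge) auto
  have "\<delta> i * x i i = - (\<Sum>c\<in>{..<k} - {i}. \<delta> c * x i c)"
    using ker[OF i(1)] i(1) by (simp add: sum.remove[of "{..<k}" i])
  then have "\<bar>\<delta> i\<bar> * \<bar>x i i\<bar> \<le> (\<Sum>c\<in>{..<k} - {i}. \<bar>\<delta> c\<bar> * \<bar>x i c\<bar>)"
    by (simp add: abs_mult[symmetric])
  also have "\<dots> \<le> (\<Sum>c\<in>{..<k} - {i}. \<bar>\<delta> i\<bar> * \<bar>x i c\<bar>)"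
    using max by (intro sum_mono mult_right_mono) auto
  finally have "\<bar>\<delta> i\<bar> * \<bar>x i i\<bar> \<le> \<bar>\<delta> i\<bar> * (\<Sum>c\<in>{..<k} - {i}. \<bar>x i c\<bar>)"
    by (simp add: sum_distrib_left)
  then have "\<delta> i = 0" using dom[OF i(1)] by (meson abs_le_zero_iff mult_le_cancel_left_pos not_le)
  then show ?thesis using max[OF c] by simp
qed

lemma card_shifted_multiples_ge:
  fixes q N s o' :: nat
  assumes q: "0 < q"
  shows "N div q \<le> card {x \<in> {o' + 1..o' + N}. q dvd x + s}"
proof -
  \<comment> \<open>The distance from \<open>o' + 1\<close> to the first solution; from there the
    solutions advance in steps of \<open>q\<close>.\<close>
  define r where "r = nat ((- int (o' + 1 + s)) mod int q)"
  have r: "int r = (- int (o' + 1 + s)) mod int q" using q by (simp add: r_def)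
  have "int q dvd int r + int (o' + 1 + s)"
    unfolding r by (simp add: mod_eq_0_iff_dvd[symmetric] mod_add_left_eq)
  then have "q dvd r + (o' + 1 + s)" by (metis int_dvd_int_iff of_nat_add)
  moreover have rq: "r < q" using r q by (metis of_nat_0_less_iff of_nat_less_iff pos_mod_bound)
  define f where "f y = o' + 1 + r + q * y" for y
  have "f ` {..<N div q} \<subseteq> {x \<in> {o' + 1..o' + N}. q dvd x + s}"
  proof (rule image_subsetI)
    fix y assume "y \<in> {..<N div q}"
    then have "q * Suc y \<le> q * (N div q)" by (intro mult_left_mono) auto
    also have "\<dots> \<le> N" by simp
    finally have "1 + r + q * y \<le> N" using rq by simp
    moreover have "q dvd f y + s"
    proof -
      have "f y + s = (r + (o' + 1 + s)) + q * y" by (simp add: f_def)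
      then show ?thesis using \<open>q dvd r + (o' + 1 + s)\<close> by (metis dvd_add dvd_triv_left)
    qed
    ultimately show "f y \<in> {x \<in> {o' + 1..o' + N}. q dvd x + s}" by (simp add: f_def)
  qed
  then have "card (f ` {..<N div q}) \<le> card {x \<in> {o' + 1..o' + N}. q dvd x + s}"
    by (intro card_mono) auto
  moreover have "inj_on f {..<N div q}" using q by (auto simp: inj_on_def f_def)
  ultimately show ?thesis by (simp add: card_image)
qed

section \<open>Integer points on the chosen subspaces\<close>

definition congruent_box :: "nat \<Rightarrow> nat \<Rightarrow> (nat \<Rightarrow> nat) \<Rightarrow> nat \<Rightarrow> (nat \<Rightarrow> nat) \<Rightarrow> (nat \<Rightarrow> nat) set" where
  "congruent_box k q a N z = {x \<in> PiE {..<k} (\<lambda>c. {z c + 1..z c + N}). q dvd (\<Sum>c<k. a c * x c)}"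

lemma finite_congruent_box [simp]: "finite (congruent_box k q a N z)"
  unfolding congruent_box_def by (simp add: finite_PiE)

text \<open>Since \<open>a 0 = 1\<close>, the coordinates other than 0 can be chosen freely, and
  coordinate 0 then has to lie in one residue class modulo \<open>q\<close>.\<close>

lemma card_congruent_box_ge:
  assumes q: "0 < q" and a: "a 0 = 1" and k: "0 < k"
  shows "N ^ (k - 1) * (N div q) \<le> card (congruent_box k q a N z)"
proof -
  let ?R = "PiE {1..<k} (\<lambda>c. {z c + 1..z c + N})"
  let ?X = "\<lambda>x. {y \<in> {z 0 + 1..z 0 + N}. q dvd y + (\<Sum>c=1..<k. a c * x c)}"
  define f where "f = (\<lambda>(x :: nat \<Rightarrow> nat, y). x(0 := y))"
  have k': "{..<k} = insert 0 {1..<k}" using k by auto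
  have "inj_on f (Sigma ?R ?X)"
  proof (rule inj_onI, clarify)
    fix x y x' y' assume x: "x \<in> ?R" "x' \<in> ?R" and eq: "f (x, y) = f (x', y')"
    have "y = y'" using fun_cong[OF eq, of 0] by (simp add: f_def)
    moreover have "x c = x' c" for c
    proof (cases "c = 0")
      case True
      then show ?thesis using x by (simp add: PiE_def extensional_def)
    next
      case False
      then show ?thesis using fun_cong[OF eq, of c] by (simp add: f_def)
    qed
    ultimately show "x = x' \<and> y = y'" by blast
  qed
  moreover have "f ` Sigma ?R ?X \<subseteq> congruent_box k q a N z"
  proof clarify
    fix x y assume x: "x \<in> ?R" and y: "y \<in> {z 0 + 1..z 0 + N}" and d: "q dvd y + (\<Sum>c=1..<k. a c * x c)"
    have "(\<Sum>c<k. a c * (x(0 := y)) c) = y + (\<Sum>c=1..<k. a c * x c)"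
      unfolding k' using a by simp
    moreover have "x(0 := y) \<in> PiE {..<k} (\<lambda>c. {z c + 1..z c + N})"
      using x y k' unfolding k' by (intro PiE_fun_upd) auto
    ultimately show "f (x, y) \<in> congruent_box k q a N z" using d by (simp add: congruent_box_def f_def)
  qed
  ultimately have "card (Sigma ?R ?X) \<le> card (congruent_box k q a N z)"
    by (rule card_inj_on_le) simp
  moreover have "N ^ (k - 1) * (N div q) \<le> card (Sigma ?R ?X)"
  proof -
    have "N ^ (k - 1) * (N div q) = (\<Sum>x\<in>?R. N div q)" by (simp add: card_PiE)
    also have "\<dots> \<le> (\<Sum>x\<in>?R. card (?X x))" by (intro sum_mono card_shifted_multiples_ge q)
    also have "\<dots> = card (Sigma ?R ?X)" by (simp add: card_SigmaI finite_PiE)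
    finally show ?thesis .
  qed
  ultimately show ?thesis by linarith
qed

text \<open>Makes the leading \<open>k \<times> k\<close> block diagonally dominant, so that the matrix determines its row space.\<close>
definition box_offset :: "nat \<Rightarrow> nat \<Rightarrow> nat \<Rightarrow> nat \<Rightarrow> nat" where
  "box_offset k N i c = (if c = i then k * N else 0)"

text \<open>Reducing \<open>a\<^sub>c b\<^sub>j\<close> modulo \<open>q\<close> bounds the coefficients by \<open>q\<close>, which keeps the entries in the box.\<close>
definition column_coeff :: "nat \<Rightarrow> (nat \<Rightarrow> nat) \<Rightarrow> (nat \<Rightarrow> nat) \<Rightarrow> nat \<Rightarrow> nat \<Rightarrow> nat" where
  "column_coeff q a b c j = (if c = 0 then b j else a c * b j mod q)"

definition extend_row :: "nat \<Rightarrow> nat \<Rightarrow> (nat \<Rightarrow> nat) \<Rightarrow> (nat \<Rightarrow> nat) \<Rightarrow> (nat \<Rightarrow> nat) \<Rightarrow> nat \<Rightarrow> nat" where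
  "extend_row k q a b x j =
     (if j < k then x j else (\<Sum>c<k. column_coeff q a b c j * x c) div q)"

definition slopes :: "nat \<Rightarrow> nat \<Rightarrow> (nat \<Rightarrow> nat) set" where
  "slopes k q = PiE {..<k} (\<lambda>c. if c = 0 then {1} else {..<q})"

text \<open>The entry at \<open>k\<close> is coprime to \<open>q\<close>, which makes
  \<open>q\<close> and \<open>a\<close> recoverable from the subspace. Starting at 1 instead of 0
  keeps the extended entries positive.\<close>

definition numerators :: "nat \<Rightarrow> nat \<Rightarrow> nat \<Rightarrow> (nat \<Rightarrow> nat) set" where
  "numerators k D q = PiE {k..<D} (\<lambda>j. if j = k then totatives q else {1..q})"

lemma congruent_boxD: "x \<in> congruent_box k q a N z \<Longrightarrow> c < k \<Longrightarrow> x c \<in> {z c + 1..z c + N}"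
  unfolding congruent_box_def using PiE_mem[of x "{..<k}" "\<lambda>c. {z c + 1..z c + N}" c] by simp

lemma slopesD:
  assumes "a \<in> slopes k q" "c < k"
  shows "c = 0 \<Longrightarrow> a c = 1" and "c \<noteq> 0 \<Longrightarrow> a c < q"
  using PiE_mem[OF assms(1)[unfolded slopes_def], of c] assms(2) by simp_all

lemma numeratorsD:
  assumes "b \<in> numerators k D q" "k \<le> j" "j < D" "0 < q"
  shows "b j \<in> {1..q}" and "j = k \<Longrightarrow> coprime (b j) q"
  using PiE_mem[OF assms(1)[unfolded numerators_def], of j] assms(2-)
  by (cases "j = k"; simp add: in_totatives_iff)+

text \<open>Modulo \<open>q\<close> the coefficient of \<open>x c\<close> is
  \<open>a c * b j\<close>, so the sum is congruent to \<open>b j\<close> times the sum that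
  \<open>congruent_box\<close> makes divisible by \<open>q\<close>. Hence the truncating division in
  \<open>extend_row\<close> is exact.\<close>

lemma extend_row_exact:
  assumes x: "x \<in> congruent_box k q a N z" and a: "a 0 = 1" and j: "k \<le> j"
  shows "q * extend_row k q a b x j = (\<Sum>c<k. column_coeff q a b c j * x c)"
proof -
  have "(\<Sum>c<k. column_coeff q a b c j * x c) mod q = (\<Sum>c<k. (column_coeff q a b c j * x c) mod q) mod q"
    by (rule mod_sum_eq[symmetric])
  also have "(\<Sum>c<k. (column_coeff q a b c j * x c) mod q) = (\<Sum>c<k. (b j * (a c * x c)) mod q)"
  proof (rule sum.cong)
    fix c
    have "(column_coeff q a b c j * x c) mod q = (a c * b j * x c) mod q"
      using a by (simp add: column_coeff_def mod_mult_left_eq)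
    then show "(column_coeff q a b c j * x c) mod q = (b j * (a c * x c)) mod q" by (simp add: mult_ac)
  qed simp
  also have "\<dots> mod q = (b j * (\<Sum>c<k. a c * x c)) mod q" by (simp add: mod_sum_eq sum_distrib_left)
  also have "\<dots> = 0" using x by (simp add: congruent_box_def)
  finally have "q dvd (\<Sum>c<k. column_coeff q a b c j * x c)" by (simp add: mod_eq_0_iff_dvd)
  then show ?thesis using j by (simp add: extend_row_def)
qed

text \<open>The coefficients are at most \<open>q\<close>, and the coordinates of \<open>x\<close>
  add up to at most \<open>2 * k * N\<close>, since at most one of them carries the offset
  \<open>k * N\<close>. Positivity comes from the term \<open>c = 0\<close>.\<close>

lemma extend_row_bounds:
  assumes x: "x \<in> congruent_box k q a N (box_offset k N i)" and a: "a \<in> slopes k q" and k: "0 < k"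
    and b: "b \<in> numerators k D q" and q: "0 < q" and j: "j < D"
  shows "extend_row k q a b x j \<in> {1..2 * k * N}"
proof -
  have xb: "x c \<in> {1..box_offset k N i c + N}" if "c < k" for c
    using congruent_boxD[OF x that] by simp
  have a0: "a 0 = 1" using slopesD(1)[OF a k] by simp
  show ?thesis
  proof (cases "j < k")
    case True
    then have "x j \<le> k * N + N" using xb[of j] by (auto simp: box_offset_def split: if_splits)
    also have "\<dots> \<le> 2 * k * N" using k by (cases k) auto
    finally show ?thesis using xb True by (simp add: extend_row_def)
  next
    case False
    then have ex: "q * extend_row k q a b x j = (\<Sum>c<k. column_coeff q a b c j * x c)"
      using extend_row_exact[OF x a0] by simp
    have bj: "b j \<in> {1..q}"
      using numeratorsD(1)[OF b _ j q] False by simp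
    have "(\<Sum>c<k. column_coeff q a b c j * x c) \<le> (\<Sum>c<k. q * (box_offset k N i c + N))"
    proof (rule sum_mono)
      fix c assume "c \<in> {..<k}"
      then have "x c \<le> box_offset k N i c + N" using xb by auto
      moreover have "column_coeff q a b c j \<le> q"
        using bj q by (auto simp: column_coeff_def intro: less_imp_le)
      ultimately show "column_coeff q a b c j * x c \<le> q * (box_offset k N i c + N)"
        by (intro mult_le_mono)
    qed
    also have "\<dots> = q * ((\<Sum>c<k. box_offset k N i c) + k * N)"
      by (simp add: sum_distrib_left[symmetric] sum.distrib)
    also have "\<dots> \<le> q * (2 * k * N)"
      by (intro mult_le_mono) (auto simp: box_offset_def)
    finally have "q * extend_row k q a b x j \<le> q * (2 * k * N)" unfolding ex .
    then have "extend_row k q a b x j \<le> 2 * k * N" using q by (simp only: nat_mult_le_cancel1)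
    moreover have "0 < (\<Sum>c<k. column_coeff q a b c j * x c)"
    proof (rule sum_pos2[of _ 0])
      show "0 < column_coeff q a b 0 j * x 0" using bj xb[OF k] by (simp add: column_coeff_def)
    qed (use k in auto)
    then have "0 < extend_row k q a b x j" using ex by (metis nat_0_less_mult_iff)
    ultimately show ?thesis by simp
  qed
qed

text \<open>The differences of the coefficients, cleared of denominators, lie in the kernel of the
  diagonally dominant matrix formed by the \<open>x i\<close>, so the fractions agree. For
  \<open>c = 0\<close> these are \<open>b j / q\<close>; at \<open>j = k\<close> they are in lowest
  terms, which gives \<open>q\<close> and then \<open>b\<close>. Cancelling \<open>b k\<close>
  modulo \<open>q\<close> in the other fractions gives \<open>a\<close>.\<close>

lemma extend_row_determines_plane:
  assumes q: "0 < q" "0 < q'" and k: "0 < k" "k < D"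
    and a: "a \<in> slopes k q" "a' \<in> slopes k q'"
    and b: "b \<in> numerators k D q" "b' \<in> numerators k D q'"
    and x: "\<And>i. i < k \<Longrightarrow> x i \<in> congruent_box k q a N (box_offset k N i)"
      "\<And>i. i < k \<Longrightarrow> x i \<in> congruent_box k q' a' N (box_offset k N i)"
    and eq: "\<And>i j. i < k \<Longrightarrow> k \<le> j \<Longrightarrow> j < D \<Longrightarrow> extend_row k q a b (x i) j = extend_row k q' a' b' (x i) j"
  shows "q = q' \<and> a = a' \<and> b = b'"
proof -
  have a0: "a 0 = 1" "a' 0 = 1" using slopesD(1)[OF a(1) k(1)] slopesD(1)[OF a(2) k(1)] by simp_all
  have coeff: "column_coeff q a b c j * q' = column_coeff q' a' b' c j * q"
    if c: "c < k" and j: "k \<le> j" "j < D" for c j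
  proof -
    define \<delta> where "\<delta> c = real (column_coeff q a b c j * q') - real (column_coeff q' a' b' c j * q)" for c
    have "\<delta> c = 0"
    proof (rule diagonally_dominant_kernel[OF _ _ c])
      fix i assume i: "i < k"
      have xb: "x i c \<in> {box_offset k N i c + 1..box_offset k N i c + N}" if "c < k" for c
        using congruent_boxD[OF x(1)[OF i] that] .
      \<comment> \<open>The off-diagonal entries are at most \<open>N\<close> each, while the offset
        lifts the diagonal entry above \<open>k * N\<close>.\<close>
      have "(\<Sum>c\<in>{..<k} - {i}. \<bar>real (x i c)\<bar>) \<le> (\<Sum>c\<in>{..<k} - {i}. real N)"
      proof (rule sum_mono)
        fix c assume "c \<in> {..<k} - {i}"
        then show "\<bar>real (x i c)\<bar> \<le> real N" using xb[of c] by (simp add: box_offset_def)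
      qed
      also have "\<dots> \<le> (\<Sum>c<k. real N)" by (intro sum_mono2) auto
      also have "\<dots> = real (k * N)" by simp
      also have "\<dots> < real (x i i)" using xb[OF i] by (simp add: box_offset_def del: of_nat_mult)
      finally show "(\<Sum>c\<in>{..<k} - {i}. \<bar>real (x i c)\<bar>) < \<bar>real (x i i)\<bar>" by simp
      have 1: "q * extend_row k q a b (x i) j = (\<Sum>c<k. column_coeff q a b c j * x i c)"
        by (rule extend_row_exact[OF x(1)[OF i] a0(1) j(1)])
      have 2: "q' * extend_row k q' a' b' (x i) j = (\<Sum>c<k. column_coeff q' a' b' c j * x i c)"
        by (rule extend_row_exact[OF x(2)[OF i] a0(2) j(1)])
      have "q' * (\<Sum>c<k. column_coeff q a b c j * x i c) = q * (\<Sum>c<k. column_coeff q' a' b' c j * x i c)"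
        unfolding 1[symmetric] 2[symmetric] eq[OF i j] by simp
      then have "real (q' * (\<Sum>c<k. column_coeff q a b c j * x i c))
          = real (q * (\<Sum>c<k. column_coeff q' a' b' c j * x i c))" by simp
      then show "(\<Sum>c<k. \<delta> c * real (x i c)) = 0"
        by (simp add: \<delta>_def sum_subtractf sum_distrib_left algebra_simps)
    qed
    then have "real (column_coeff q a b c j * q') = real (column_coeff q' a' b' c j * q)"
      by (simp add: \<delta>_def)
    then show ?thesis by (simp only: of_nat_eq_iff)
  qed
  have bq: "b j * q' = b' j * q" if "k \<le> j" "j < D" for j
    using coeff[OF k(1) that] by (simp add: column_coeff_def)
  have cop: "coprime (b k) q" "coprime (b' k) q'"
    using numeratorsD(2)[OF b(1) _ k(2) q(1)] numeratorsD(2)[OF b(2) _ k(2) q(2)] by simp_all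
  have "q dvd b k * q'" "q' dvd b' k * q" using bq[of k] k(2) by (metis dvd_triv_right order_refl)+
  then have qq: "q = q'"
    using cop by (metis coprime_commute coprime_dvd_mult_right_iff dvd_antisym)
  have bb: "b j = b' j" if "k \<le> j" "j < D" for j using bq[OF that] q by (simp add: qq)
  have "b = b'"
    using b bb unfolding numerators_def by (intro PiE_ext[of b _ _ b']) auto
  moreover have "a = a'"
  proof -
    have "a c = a' c" if c: "c < k" for c
    proof (cases "c = 0")
      case True
      then show ?thesis using a0 by simp
    next
      case False
      then have "a c * b k mod q = a' c * b k mod q"
        using coeff[OF c, of k] k(2) q by (simp add: column_coeff_def qq bb)
      then have "[a c * b k = a' c * b k] (mod q)" by (simp add: cong_def)
      then have "[a c = a' c] (mod q)" using cop(1) by (simp add: cong_mult_rcancel_nat)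
      moreover have "a c < q" "a' c < q" using slopesD(2)[OF a(1) c False] slopesD(2)[OF a(2) c False] by (simp_all add: qq)
      ultimately show ?thesis by (rule cong_less_modulus_unique_nat)
    qed
    then show ?thesis using a unfolding slopes_def by (intro PiE_ext[of a _ _ a']) auto
  qed
  ultimately show ?thesis using qq by simp
qed

text \<open>By the divisor sum of the totient, \<open>1 / q\<close> is the sum of
  \<open>totient e / q ^ 2\<close> over the divisors \<open>e\<close> of \<open>q\<close>. Writing
  \<open>q = e * g\<close> and letting \<open>e\<close> and \<open>g\<close> range independently up
  to \<open>N\<close> bounds the harmonic sum by the sum in question times that of
  \<open>1 / g ^ 2\<close>, which is at most 2.\<close>

lemma sum_totient_ge:
  "ln (real N + 1) / 2 \<le> (\<Sum>q=1..N. real (totient q) / (real q)\<^sup>2)"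
proof -
  have "ln (real N + 1) \<le> harm N" by (rule ln_le_harm)
  also have "\<dots> = (\<Sum>q=1..N. \<Sum>e | e dvd q. real (totient e) / (real q)\<^sup>2)"
    unfolding harm_def
  proof (rule sum.cong)
    fix q assume "q \<in> {1..N}"
    have "(\<Sum>e | e dvd q. real (totient e) / (real q)\<^sup>2) = real (\<Sum>e | e dvd q. totient e) / (real q)\<^sup>2"
      by (simp add: sum_divide_distrib)
    also have "\<dots> = inverse (real q)"
      unfolding totient_divisor_sum by (simp add: field_simps power2_eq_square)
    finally show "inverse (real q) = (\<Sum>e | e dvd q. real (totient e) / (real q)\<^sup>2)" ..
  qed simp
  also have "\<dots> = (\<Sum>(q, e)\<in>Sigma {1..N} (\<lambda>q. {e. e dvd q}). real (totient e) / (real q)\<^sup>2)"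
    by (rule sum.Sigma) auto
  also have "\<dots> \<le> (\<Sum>(e, g)\<in>{1..N} \<times> {1..N}. real (totient e) / (real e)\<^sup>2 * (1 / (real g)\<^sup>2))"
  proof (rule sum_le_included[where i = "\<lambda>(e, g). (e * g, e)"])
    show "\<forall>x\<in>Sigma {1..N} (\<lambda>q. {e. e dvd q}). \<exists>y\<in>{1..N} \<times> {1..N}.
        (case y of (e, g) \<Rightarrow> (e * g, e)) = x \<and>
        (case x of (q, e) \<Rightarrow> real (totient e) / (real q)\<^sup>2)
          \<le> (case y of (e, g) \<Rightarrow> real (totient e) / (real e)\<^sup>2 * (1 / (real g)\<^sup>2))"
    proof clarify
      fix q e :: nat assume q: "q \<in> {1..N}" and "e dvd q"
      then obtain g where g: "q = e * g" by (auto elim: dvdE)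
      have "e > 0" "g > 0" using q g by auto
      have "e * g \<le> N" using q g by simp
      moreover have "e \<le> e * g" "g \<le> e * g" using \<open>e > 0\<close> \<open>g > 0\<close> by simp_all
      ultimately have "e \<le> N" "g \<le> N" by (blast intro: order_trans)+
      then have "(e, g) \<in> {1..N} \<times> {1..N}" using \<open>e > 0\<close> \<open>g > 0\<close> by simp
      then show "\<exists>y\<in>{1..N} \<times> {1..N}. (case y of (e, g) \<Rightarrow> (e * g, e)) = (q, e) \<and>
        real (totient e) / (real q)\<^sup>2
          \<le> (case y of (e, g) \<Rightarrow> real (totient e) / (real e)\<^sup>2 * (1 / (real g)\<^sup>2))"
        by (intro bexI[of _ "(e, g)"]) (auto simp: g power_mult_distrib)
    qed
  qed (auto intro!: finite_SigmaI)
  also have "\<dots> = (\<Sum>e=1..N. real (totient e) / (real e)\<^sup>2) * (\<Sum>g=1..N. 1 / (real g)\<^sup>2)"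
    by (simp only: sum_product sum.cartesian_product)
  also have "\<dots> \<le> (\<Sum>e=1..N. real (totient e) / (real e)\<^sup>2) * 2"
    by (intro mult_left_mono sum_inverse_squares_le sum_nonneg) auto
  finally show ?thesis by simp
qed


section \<open>Large families of matrices of low rank\<close>

lemma finite_low_rank: "finite (low_rank n k :: ('a::finite \<Rightarrow> 'b::finite \<Rightarrow> int) set)"
proof (rule finite_subset)
  show "low_rank n k \<subseteq> PiE (UNIV :: 'a set) (\<lambda>_. PiE (UNIV :: 'b set) (\<lambda>_. {1..int n}))"
    by (auto simp: low_rank_def PiE_UNIV_domain)
qed (auto intro!: finite_PiE)

lemma rank_le_if_columns_dependent:
  fixes A :: "real^'b::finite^'a::finite"
  assumes "\<And>j. \<exists>w. \<forall>l. A $ l $ j = (\<Sum>c<k. w c * A $ l $ g c)"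
  shows "rank A \<le> k"
proof -
  let ?B = "(\<lambda>c. column (g c) A) ` {..<k}"
  have "columns A \<subseteq> span ?B"
  proof
    fix v assume "v \<in> columns A"
    then obtain j where v: "v = column j A" by (auto simp: columns_def)
    obtain w where w: "\<And>l. A $ l $ j = (\<Sum>c<k. w c * A $ l $ g c)" using assms by blast
    have "v = (\<Sum>c<k. w c *\<^sub>R column (g c) A)"
      using w by (simp add: v column_def vec_eq_iff)
    moreover have "w c *\<^sub>R column (g c) A \<in> span ?B" if "c \<in> {..<k}" for c
      using that by (intro span_scale span_base imageI)
    ultimately show "v \<in> span ?B" by (metis (no_types, lifting) span_sum)
  qed
  then have "dim (columns A) \<le> card ?B" by (intro dim_le_card) auto
  also have "\<dots> \<le> k" using card_image_le[of "{..<k}" "\<lambda>c. column (g c) A"] by simp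
  finally show ?thesis by (simp add: column_rank_def)
qed

text \<open>The factors count the slopes, the numerators and the rows in the resulting subspace. No
  matrix is counted twice: its first \<open>k\<close> columns show \<open>x\<close>, and its first
  \<open>k\<close> rows determine the subspace.\<close>

lemma card_low_rank_ge_sum:
  fixes k N n :: nat
  assumes k: "0 < k" "k < CARD('b::finite)" "k \<le> CARD('a::finite)" and n: "2 * k * N \<le> n"
  shows "(\<Sum>q=1..N. q ^ (k - 1) * (totient q * q ^ (CARD('b) - k - 1)) * (N ^ (k - 1) * (N div q)) ^ CARD('a))
    \<le> card (low_rank n k :: ('a \<Rightarrow> 'b \<Rightarrow> int) set)"
    (is "_ \<le> card ?S")
proof -
  let ?D = "CARD('b)"
  obtain r where "bij_betw r (UNIV :: 'a set) {0..<CARD('a)}" using ex_bij_betw_finite_nat[of "UNIV :: 'a set"] by auto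
  then have r: "bij_betw r (UNIV :: 'a set) {..<CARD('a)}" by (simp add: atLeast0LessThan)
  obtain s where "bij_betw s (UNIV :: 'b set) {0..<?D}" using ex_bij_betw_finite_nat[of "UNIV :: 'b set"] by auto
  then have s: "bij_betw s (UNIV :: 'b set) {..<?D}" by (simp add: atLeast0LessThan)
  have s_less: "s j < ?D" for j using s by (auto simp: bij_betw_def)
  have s_ex: "\<exists>j. s j = c" if "c < ?D" for c
  proof -
    have "c \<in> s ` UNIV" using s that by (simp add: bij_betw_def)
    then show ?thesis by blast
  qed
  have r_ex: "\<exists>l. r l = c" if "c < CARD('a)" for c
  proof -
    have "c \<in> r ` UNIV" using r that by (simp add: bij_betw_def)
    then show ?thesis by blast
  qed
  \<comment> \<open>Only the rows numbered below \<open>k\<close> are shifted; for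
    \<open>r l \<ge> k\<close> the offset vanishes at every \<open>c < k\<close>.\<close>
  let ?X = "\<lambda>q a. PiE (UNIV :: 'a set) (\<lambda>l. congruent_box k q a N (box_offset k N (r l)))"
  define Z where "Z = Sigma {1..N} (\<lambda>q. Sigma (slopes k q) (\<lambda>a. numerators k ?D q \<times> ?X q a))"
  define f where "f = (\<lambda>(q, a, b, x) (l :: 'a) (j :: 'b). int (extend_row k q a b (x l) (s j)))"
  have fin_slopes: "finite (slopes k q)" for q unfolding slopes_def by (intro finite_PiE) auto
  have fin_numerators: "finite (numerators k ?D q)" for q unfolding numerators_def by (intro finite_PiE) auto
  have finX: "finite (?X q a)" for q a by (intro finite_PiE) auto
  have "inj_on f Z"
  proof (rule inj_onI)
    fix u v assume uv: "u \<in> Z" "v \<in> Z" "f u = f v"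
    obtain q a b x q' a' b' x' where u: "u = (q, a, b, x)" and v: "v = (q', a', b', x')"
      by (cases u, cases v) blast
    have Z: "(q, a, b, x) \<in> Z" "(q', a', b', x') \<in> Z" and eq: "f (q, a, b, x) = f (q', a', b', x')"
      using uv unfolding u v by blast+
    have q: "0 < q" "0 < q'" using Z by (auto simp: Z_def)
    have a: "a \<in> slopes k q" "a' \<in> slopes k q'" and b: "b \<in> numerators k ?D q" "b' \<in> numerators k ?D q'"
      using Z by (auto simp: Z_def)
    have "x \<in> ?X q a" "x' \<in> ?X q' a'" using Z by (auto simp: Z_def)
    then have x: "x l \<in> congruent_box k q a N (box_offset k N (r l))"
      "x' l \<in> congruent_box k q' a' N (box_offset k N (r l))" for l by (auto simp: PiE_iff)
    have e: "extend_row k q a b (x l) c = extend_row k q' a' b' (x' l) c" if c: "c < ?D" for l c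
    proof -
      obtain j where "s j = c" using s_ex[OF c] by blast
      then show ?thesis using fun_cong[OF fun_cong[OF eq, of l], of j] by (simp add: f_def)
    qed
    have xx: "x l = x' l" for l
    proof (rule PiE_ext)
      show "x l \<in> PiE {..<k} (\<lambda>c. {box_offset k N (r l) c + 1..box_offset k N (r l) c + N})"
        "x' l \<in> PiE {..<k} (\<lambda>c. {box_offset k N (r l) c + 1..box_offset k N (r l) c + N})"
        using x by (simp_all add: congruent_box_def)
      fix c assume "c \<in> {..<k}"
      then show "x l c = x' l c" using e[of c l] k(2) by (simp add: extend_row_def)
    qed
    obtain t where t: "\<And>i. i < CARD('a) \<Longrightarrow> r (t i) = i" using r_ex by metis
    have "q = q' \<and> a = a' \<and> b = b'"
    proof (rule extend_row_determines_plane[OF q k(1,2) a b])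
      fix i assume "i < k"
      then have ti: "r (t i) = i" using t k(3) by simp
      show "x (t i) \<in> congruent_box k q a N (box_offset k N i)" using x(1)[of "t i"] ti by simp
      show "x (t i) \<in> congruent_box k q' a' N (box_offset k N i)" using x(2)[of "t i"] ti xx by simp
      fix j assume "j < ?D"
      then show "extend_row k q a b (x (t i)) j = extend_row k q' a' b' (x (t i)) j" using e xx by simp
    qed
    moreover have "x = x'" using xx by blast
    ultimately show "u = v" by (simp add: u v)
  qed
  moreover have "f ` Z \<subseteq> ?S"
    unfolding low_rank_def
  proof clarify
    fix q a b x assume "(q, a, b, x) \<in> Z"
    then have q: "0 < q" and a: "a \<in> slopes k q" and b: "b \<in> numerators k ?D q"
      and "x \<in> ?X q a" by (auto simp: Z_def)
    then have x: "x l \<in> congruent_box k q a N (box_offset k N (r l))" for l by (auto simp: PiE_iff)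
    have a0: "a 0 = 1" using slopesD(1)[OF a k(1)] by simp
    have 1: "f (q, a, b, x) l j \<in> {1..int n}" for l j
      using extend_row_bounds[OF x a k(1) b q s_less, of l j] n by (simp add: f_def)
    obtain g where g: "\<And>c. c < ?D \<Longrightarrow> s (g c) = c" using s_ex by metis
    let ?A = "\<chi> l j. real_of_int (f (q, a, b, x) l j)"
    have base: "?A $ l $ g c = real (x l c)" if "c < k" for l c
      using that g[of c] k(2) by (simp add: f_def extend_row_def)
    have "rank ?A \<le> k"
    proof (rule rank_le_if_columns_dependent[where g = g])
      fix j
      show "\<exists>w. \<forall>l. ?A $ l $ j = (\<Sum>c<k. w c * ?A $ l $ g c)"
      proof (cases "s j < k")
        case True
        have "?A $ l $ j = (\<Sum>c<k. (if c = s j then 1 else 0) * ?A $ l $ g c)" for l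
        proof -
          have "(\<Sum>c<k. (if c = s j then 1 else 0) * ?A $ l $ g c) = (\<Sum>c<k. if c = s j then real (x l c) else 0)"
            using base by (intro sum.cong) auto
          then show ?thesis using True by (simp add: f_def extend_row_def)
        qed
        then show ?thesis by (intro exI[of _ "\<lambda>c. if c = s j then 1 else 0"]) blast
      next
        case False
        have "?A $ l $ j = (\<Sum>c<k. real (column_coeff q a b c (s j)) / real q * ?A $ l $ g c)" for l
        proof -
          have "real (q * extend_row k q a b (x l) (s j)) = real (\<Sum>c<k. column_coeff q a b c (s j) * x l c)"
            using extend_row_exact[OF x[of l] a0, of "s j" b] False by simp
          then have "real (extend_row k q a b (x l) (s j))
              = (\<Sum>c<k. real (column_coeff q a b c (s j)) * real (x l c)) / real q"
            using q by (simp add: field_simps)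
          also have "\<dots> = (\<Sum>c<k. real (column_coeff q a b c (s j)) / real q * ?A $ l $ g c)"
            unfolding sum_divide_distrib using base by (intro sum.cong) auto
          finally show ?thesis by (simp add: f_def)
        qed
        then show ?thesis by (intro exI[of _ "\<lambda>c. real (column_coeff q a b c (s j)) / real q"]) blast
      qed
    qed
    with 1 show "(\<forall>l j. f (q, a, b, x) l j \<in> {1..int n}) \<and> rank ?A \<le> k" by blast
  qed
  moreover have "finite ?S" by (rule finite_low_rank)
  ultimately have "card Z \<le> card ?S" by (rule card_inj_on_le)
  moreover have "(\<Sum>q=1..N. q ^ (k - 1) * (totient q * q ^ (?D - k - 1)) * (N ^ (k - 1) * (N div q)) ^ CARD('a)) \<le> card Z"
  proof -
    have cs: "card (slopes k q) = q ^ (k - 1)" for q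
    proof -
      have "{..<k} = insert 0 {1..<k}" using k by auto
      then show ?thesis by (simp add: slopes_def card_PiE)
    qed
    have cn: "card (numerators k ?D q) = totient q * q ^ (?D - k - 1)" for q
    proof -
      have "{k..<?D} = insert k {Suc k..<?D}" using k by auto
      then show ?thesis by (simp add: numerators_def card_PiE totient_def)
    qed
    have cX: "(N ^ (k - 1) * (N div q)) ^ CARD('a) \<le> card (?X q a)" if "a \<in> slopes k q" "q \<in> {1..N}" for q a
    proof -
      have "(N ^ (k - 1) * (N div q)) ^ CARD('a) = (\<Prod>l\<in>(UNIV :: 'a set). N ^ (k - 1) * (N div q))" by simp
      also have "\<dots> \<le> (\<Prod>l\<in>(UNIV :: 'a set). card (congruent_box k q a N (box_offset k N (r l))))"
        using that slopesD(1)[OF that(1) k(1)] by (intro prod_mono conjI card_congruent_box_ge k) auto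
      finally show ?thesis by (simp add: card_PiE)
    qed
    have "(\<Sum>q=1..N. q ^ (k - 1) * (totient q * q ^ (?D - k - 1)) * (N ^ (k - 1) * (N div q)) ^ CARD('a))
      = (\<Sum>q=1..N. \<Sum>a\<in>slopes k q. card (numerators k ?D q) * (N ^ (k - 1) * (N div q)) ^ CARD('a))"
      by (simp add: cs cn mult.assoc)
    also have "\<dots> \<le> (\<Sum>q=1..N. \<Sum>a\<in>slopes k q. card (numerators k ?D q) * card (?X q a))"
      using cX by (intro sum_mono mult_left_mono) auto
    also have "\<dots> = card Z"
      unfolding Z_def using fin_slopes fin_numerators finX
      by (simp add: card_SigmaI card_cartesian_product)
    finally show ?thesis .
  qed
  ultimately show ?thesis by linarith
qed

text \<open>For \<open>q \<le> N\<close>, \<open>N div q\<close> is at least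
  \<open>N / (2 * q)\<close>. The resulting power \<open>q ^ CARD('a)\<close> in the denominator
  exceeds \<open>q ^ (k - 1) * q ^ (CARD('a) - k - 1)\<close> by exactly two factors, which leaves
  \<open>totient q / q ^ 2\<close>.\<close>

lemma card_low_rank_square_ge:
  fixes k N n :: nat
  assumes k: "0 < k" "k < CARD('a::finite)" and ab: "CARD('a) = CARD('b::finite)" and n: "2 * k * N \<le> n"
  shows "real N ^ (k * CARD('a)) * (ln (real N + 1) / 2 ^ (CARD('a) + 1))
    \<le> real (card (low_rank n k :: ('a \<Rightarrow> 'b \<Rightarrow> int) set))"
proof -
  let ?D = "CARD('a)"
  let ?t = "\<lambda>q. q ^ (k - 1) * (totient q * q ^ (?D - k - 1)) * (N ^ (k - 1) * (N div q)) ^ ?D"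
  have "real N ^ (k * ?D) / 2 ^ ?D * (ln (real N + 1) / 2)
    \<le> real N ^ (k * ?D) / 2 ^ ?D * (\<Sum>q=1..N. real (totient q) / (real q)\<^sup>2)"
    by (intro mult_left_mono sum_totient_ge) auto
  also have "\<dots> \<le> real (\<Sum>q=1..N. ?t q)"
    unfolding sum_distrib_left of_nat_sum
  proof (rule sum_mono)
    fix q assume "q \<in> {1..N}"
    then have q: "1 \<le> q" "q \<le> N" by auto
    have "N < q * (N div q + 1)" using q dividend_less_div_times[of q N] by (simp add: algebra_simps)
    also have "\<dots> \<le> q * (2 * (N div q))"
      using q div_le_mono[of q N q] by (intro mult_le_mono) auto
    finally have "real N \<le> real (q * (2 * (N div q)))" by (simp only: of_nat_le_iff less_imp_le)
    then have "real N / (2 * real q) \<le> real (N div q)" using q by (simp add: field_simps)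
    then have "real N ^ (k - 1) * (real N / (2 * real q)) \<le> real (N ^ (k - 1) * (N div q))"
      unfolding of_nat_mult of_nat_power by (rule mult_left_mono) simp
    then have "(real N ^ (k - 1) * (real N / (2 * real q))) ^ ?D \<le> real (N ^ (k - 1) * (N div q)) ^ ?D"
      by (intro power_mono) auto
    moreover have "real N ^ (k - 1) * (real N / (2 * real q)) = real N ^ k / (2 * real q)"
      using k by (cases k) auto
    ultimately have le: "(real N ^ k / (2 * real q)) ^ ?D \<le> real (N ^ (k - 1) * (N div q)) ^ ?D"
      by (simp only:)
    have D: "?D = 2 + ((k - 1) + (?D - k - 1))" using k by simp
    have "real N ^ (k * ?D) / 2 ^ ?D * (real (totient q) / (real q)\<^sup>2)
      = real q ^ (k - 1) * (real (totient q) * real q ^ (?D - k - 1)) * (real N ^ k / (2 * real q)) ^ ?D"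
    proof -
      have "real q ^ ?D = (real q)\<^sup>2 * (real q ^ (k - 1) * real q ^ (?D - k - 1))"
        by (subst D) (simp only: power_add)
      then show ?thesis
        using q by (simp add: power_divide power_mult_distrib power_mult)
    qed
    also have "\<dots> \<le> real q ^ (k - 1) * (real (totient q) * real q ^ (?D - k - 1)) * real (N ^ (k - 1) * (N div q)) ^ ?D"
      using le by (intro mult_left_mono) auto
    also have "\<dots> = real (?t q)" by simp
    finally show "real N ^ (k * ?D) / 2 ^ ?D * (real (totient q) / (real q)\<^sup>2) \<le> real (?t q)" .
  qed
  also have "\<dots> \<le> real (card (low_rank n k :: ('a \<Rightarrow> 'b \<Rightarrow> int) set))"
    using card_low_rank_ge_sum[where 'a = 'a and 'b = 'b, of k N n] k n ab by (simp only: of_nat_le_iff)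
  finally show ?thesis by (simp add: mult_ac)
qed

text \<open>The rows in \<open>T\<close> are free and all others copy row \<open>l0\<close>, so at
  most \<open>k\<close> different rows occur. This order of growth is sharp when there are more
  columns than rows.\<close>

lemma card_low_rank_ge:
  fixes k n :: nat
  assumes k: "0 < k" "k \<le> CARD('a::finite)"
  shows "n ^ (k * CARD('b::finite))
    \<le> card (low_rank n k :: ('a \<Rightarrow> 'b \<Rightarrow> int) set)"
    (is "_ \<le> card ?S")
proof -
  obtain T :: "'a set" where T: "card T = k" using obtain_subset_with_card_n[OF k(2)] by auto
  then obtain l0 where l0: "l0 \<in> T" using k(1) by fastforce
  have finT: "finite T" by simp
  define f where "f x l = x (if l \<in> T then l else l0)" for x :: "'a \<Rightarrow> 'b \<Rightarrow> int" and l
  let ?P = "PiE T (\<lambda>_. PiE (UNIV :: 'b set) (\<lambda>_. {1..int n}))"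
  have "inj_on f ?P"
  proof (rule inj_onI)
    fix x y assume x: "x \<in> ?P" "y \<in> ?P" and eq: "f x = f y"
    show "x = y"
    proof (rule PiE_ext[OF x])
      fix l assume "l \<in> T"
      then show "x l = y l" using fun_cong[OF eq, of l] by (simp add: f_def)
    qed
  qed
  moreover have "f ` ?P \<subseteq> ?S"
    unfolding low_rank_def
  proof clarify
    fix x assume x: "x \<in> ?P"
    have 1: "f x l j \<in> {1..int n}" for l j
      using PiE_mem[OF PiE_mem[OF x], of "if l \<in> T then l else l0" j] l0 by (simp add: f_def)
    let ?A = "\<chi> l j. real_of_int (f x l j)"
    have "rows ?A \<subseteq> (\<lambda>l. row l ?A) ` T"
    proof
      fix v assume "v \<in> rows ?A"
      then obtain l where "v = row l ?A" by (auto simp: rows_def)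
      then have "v = row (if l \<in> T then l else l0) ?A" using l0 by (auto simp: row_def f_def vec_eq_iff)
      then show "v \<in> (\<lambda>l. row l ?A) ` T" using l0 by auto
    qed
    then have "dim (rows ?A) \<le> card ((\<lambda>l. row l ?A) ` T)"
      by (intro dim_le_card) (auto intro: span_base)
    also have "\<dots> \<le> k" using card_image_le[OF finT] T by metis
    finally have "rank ?A \<le> k" by (simp add: row_rank_def)
    with 1 show "(\<forall>l j. f x l j \<in> {1..int n}) \<and> rank ?A \<le> k" by blast
  qed
  moreover have "finite ?S" by (rule finite_low_rank)
  ultimately have "card ?P \<le> card ?S" by (rule card_inj_on_le)
  moreover have "card ?P = n ^ (k * CARD('b))"
    using T finT by (simp add: card_PiE power_mult[symmetric] mult.commute)
  ultimately show ?thesis by simp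
qed

section \<open>Asymptotics\<close>

text \<open>Reduces the theorem to matrices with at most as many rows as columns.\<close>

lemma card_low_rank_transpose:
  "card (low_rank n k :: ('a::finite \<Rightarrow> 'b::finite \<Rightarrow> int) set) = card (low_rank n k :: ('b \<Rightarrow> 'a \<Rightarrow> int) set)"
proof (rule bij_betw_same_card)
  have rank: "rank (\<chi> j l. real_of_int (X l j)) = rank (\<chi> l j. real_of_int (X l j))" for X :: "'x::finite \<Rightarrow> 'y::finite \<Rightarrow> int"
    using rank_transpose[of "\<chi> l j. real_of_int (X l j)"] by (simp add: transpose_def)
  have mem: "(\<lambda>j l. X l j) \<in> low_rank n k" if "X \<in> low_rank n k" for X :: "'x::finite \<Rightarrow> 'y::finite \<Rightarrow> int"
    using that unfolding low_rank_def mem_Collect_eq rank[of X] by blast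
  show "bij_betw (\<lambda>X j l. X l j) (low_rank n k :: ('a \<Rightarrow> 'b \<Rightarrow> int) set) (low_rank n k)"
    by (rule bij_betwI[where g = "\<lambda>X l j. X j l"]) (simp_all add: mem)
qed

lemma L_count_eq_card_low_rank:
  assumes "k \<le> CARD('d::finite)"
  shows "L_count n TYPE('d) k TYPE('r::finite) = card (low_rank n k :: ('d \<Rightarrow> 'r \<Rightarrow> int) set)"
  unfolding L_count_eq_card_rank_le[OF assms]
proof (rule bij_betw_same_card[of "\<lambda>A l j. \<lfloor>A $ l $ j\<rfloor>"], rule bij_betwI[where g = "\<lambda>X. \<chi> l j. real_of_int (X l j)"])
  have fl: "(\<chi> l j. real_of_int \<lfloor>A $ l $ j\<rfloor>) = A"
    if A: "\<forall>i j. A $ i $ j \<in> real ` {1..n}" for A :: "real^'r^'d"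
  proof -
    have "real_of_int \<lfloor>A $ l $ j\<rfloor> = A $ l $ j" for l j
    proof -
      obtain m where "A $ l $ j = real m" using A by blast
      then show ?thesis by simp
    qed
    then show ?thesis by (simp add: vec_eq_iff)
  qed
  show "(\<lambda>A l j. \<lfloor>A $ l $ j\<rfloor>) \<in> {A :: real^'r^'d. (\<forall>i j. A $ i $ j \<in> real ` {1..n}) \<and> rank A \<le> k} \<rightarrow> low_rank n k"
  proof
    fix A :: "real^'r^'d" assume "A \<in> {A. (\<forall>i j. A $ i $ j \<in> real ` {1..n}) \<and> rank A \<le> k}"
    then have A: "\<forall>i j. A $ i $ j \<in> real ` {1..n}" "rank A \<le> k" by auto
    have "\<lfloor>A $ i $ j\<rfloor> \<in> {1..int n}" for i j
    proof -
      obtain m where "A $ i $ j = real m" "m \<in> {1..n}" using A(1) by blast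
      then show ?thesis by simp
    qed
    then show "(\<lambda>l j. \<lfloor>A $ l $ j\<rfloor>) \<in> low_rank n k" using A(2) by (simp add: low_rank_def fl[OF A(1)])
  qed
  show "(\<lambda>X. \<chi> l j. real_of_int (X l j)) \<in> low_rank n k \<rightarrow> {A :: real^'r^'d. (\<forall>i j. A $ i $ j \<in> real ` {1..n}) \<and> rank A \<le> k}"
  proof
    fix X :: "'d \<Rightarrow> 'r \<Rightarrow> int" assume X: "X \<in> low_rank n k"
    have "real_of_int (X l j) \<in> real ` {1..n}" for l j
    proof -
      have "X l j \<in> {1..int n}" using X by (simp add: low_rank_def)
      then show ?thesis by (intro image_eqI[of _ _ "nat (X l j)"]) auto
    qed
    then show "(\<chi> l j. real_of_int (X l j)) \<in> {A :: real^'r^'d. (\<forall>i j. A $ i $ j \<in> real ` {1..n}) \<and> rank A \<le> k}"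
      using X by (simp add: low_rank_def)
  qed
  show "(\<chi> l j. real_of_int \<lfloor>A $ l $ j\<rfloor>) = A"
    if "A \<in> {A :: real^'r^'d. (\<forall>i j. A $ i $ j \<in> real ` {1..n}) \<and> rank A \<le> k}" for A
    using that fl by blast
qed simp

lemma card_low_rank_bigo:
  assumes le: "CARD('a::finite) \<le> CARD('b::finite)" and k: "k \<le> CARD('a)"
  shows "(\<lambda>n. real (card (low_rank n k :: ('a \<Rightarrow> 'b \<Rightarrow> int) set)))
    \<in> O(\<lambda>n. real n ^ (k * CARD('b)) * (if CARD('a) = CARD('b) then ln (real n) else 1))"
proof -
  \<comment> \<open>Chosen so that the box size \<open>B\<close> of \<open>card_low_rank_le\<close>
    is at most \<open>M * n\<close>. The constant \<open>c\<close> absorbs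
    \<open>1 + ln (B ^ k)\<close> into a multiple of \<open>ln n\<close>, using that
    \<open>ln n\<close> is at least 1 from \<open>n = 3\<close> on.\<close>
  define M where "M = 2 * CARD('b) + 3"
  define C where "C = (\<Sum>m\<le>k. real (CARD('a) ^ m * (2 * 2 ^ k + 1) ^ (m * (CARD('a) - m)) * 2 ^ m))"
  define c where "c = (if CARD('a) = CARD('b) then 1 + real k * ln (real M) + real k else 2)"
  have "C \<ge> 0" unfolding C_def by (intro sum_nonneg) simp
  have "M \<ge> 1" by (simp add: M_def)
  have "real (card (low_rank n k :: ('a \<Rightarrow> 'b \<Rightarrow> int) set)) \<le> C * real M ^ (k * CARD('b)) * c *
      (real n ^ (k * CARD('b)) * (if CARD('a) = CARD('b) then ln (real n) else 1))" if n: "3 \<le> n" for n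
  proof -
    define B where "B = 2 * (CARD('b) * n + n) + 1"
    have BM: "B \<le> M * n" using n by (simp add: B_def M_def algebra_simps)
    have B1: "1 \<le> B" by (simp add: B_def)
    have ln1: "1 \<le> ln (real n)"
    proof -
      have "1 < ln (3 :: real)" by (rule ln3_gt_1)
      also have "ln 3 \<le> ln (real n)" using n by simp
      finally show ?thesis by simp
    qed
    define G where "G = (if CARD('a) = CARD('b) then 1 + ln (real (B ^ k)) else 2)"
    have G: "1 \<le> G" using B1 by (simp add: G_def ln_realpow)
    have Gsum: "(\<Sum>q=1..B ^ k. 1 / real q ^ (if CARD('a) = CARD('b) then 1 else 2)) \<le> G"
      using harm_le[of "B ^ k"] sum_inverse_squares_le[of "B ^ k"] B1 by (simp add: G_def)
    have Gle: "G \<le> c * (if CARD('a) = CARD('b) then ln (real n) else 1)"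
    proof (cases "CARD('a) = CARD('b)")
      case True
      have "ln (real B) \<le> ln (real (M * n))" using BM B1 by (intro ln_mono) (auto simp del: of_nat_mult)
      also have "\<dots> = ln (real M) + ln (real n)" using n \<open>M \<ge> 1\<close> by (simp add: ln_mult)
      finally have "G \<le> 1 + real k * (ln (real M) + ln (real n))"
        using True B1 by (simp add: G_def ln_realpow mult_left_mono)
      also have "\<dots> = (1 + real k * ln (real M)) * 1 + real k * ln (real n)" by (simp add: algebra_simps)
      also have "\<dots> \<le> (1 + real k * ln (real M)) * ln (real n) + real k * ln (real n)"
        using ln1 \<open>M \<ge> 1\<close> by (intro add_mono mult_left_mono) auto
      also have "\<dots> = c * ln (real n)" using True by (simp add: c_def algebra_simps)
      finally show ?thesis using True by simp
    qed (simp add: G_def c_def)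
    have "real (card (low_rank n k :: ('a \<Rightarrow> 'b \<Rightarrow> int) set)) \<le> C * real B ^ (k * CARD('b)) * G"
      unfolding C_def using le k B_def G Gsum by (rule card_low_rank_le)
    also have "\<dots> \<le> C * (real (M * n)) ^ (k * CARD('b)) * (c * (if CARD('a) = CARD('b) then ln (real n) else 1))"
      using BM \<open>C \<ge> 0\<close> Gle G
      by (intro mult_mono mult_left_mono power_mono) (auto simp del: of_nat_mult)
    finally show ?thesis by (simp add: power_mult_distrib mult_ac)
  qed
  then have "eventually (\<lambda>n. norm (real (card (low_rank n k :: ('a \<Rightarrow> 'b \<Rightarrow> int) set))) \<le>
      (C * real M ^ (k * CARD('b)) * c) *
      norm (real n ^ (k * CARD('b)) * (if CARD('a) = CARD('b) then ln (real n) else 1))) at_top"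
    by (intro eventually_mono[OF eventually_ge_at_top[of 3]]) auto
  then show ?thesis by (rule bigoI)
qed

lemma card_low_rank_bigomega:
  assumes le: "CARD('a::finite) \<le> CARD('b::finite)" and k: "0 < k" "k < CARD('a)"
  shows "(\<lambda>n. real (card (low_rank n k :: ('a \<Rightarrow> 'b \<Rightarrow> int) set)))
    \<in> \<Omega>(\<lambda>n. real n ^ (k * CARD('b)) * (if CARD('a) = CARD('b) then ln (real n) else 1))"
proof (cases "CARD('a) = CARD('b)")
  case False
  have "real n ^ (k * CARD('b)) \<le> real (card (low_rank n k :: ('a \<Rightarrow> 'b \<Rightarrow> int) set))" for n
    using card_low_rank_ge[where 'a = 'a and 'b = 'b, of k n] k by (simp flip: of_nat_power)
  then show ?thesis using False by (intro landau_omega.bigI[where c = 1]) auto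
next
  case True
  let ?a = "CARD('a)"
  \<comment> \<open>The factor \<open>4 * k\<close> comes from \<open>n / (4 * k) \<le> N\<close>,
    one of the factors 2 from \<open>ln n / 2 \<le> ln (N + 1)\<close>, and the others from
    \<open>card_low_rank_square_ge\<close>.\<close>
  define c where "c = 1 / ((4 * real k) ^ (k * ?a) * 2 ^ (?a + 2))"
  have c: "c > 0" using k by (simp add: c_def)
  have "c * (real n ^ (k * ?a) * ln (real n)) \<le> real (card (low_rank n k :: ('a \<Rightarrow> 'b \<Rightarrow> int) set))"
    if n: "4 * k ^ 2 + 1 \<le> n" for n
  proof -
    define N where "N = n div (2 * k)"
    have nN: "n < 2 * k * (N + 1)"
      using k dividend_less_div_times[of "2 * k" n] by (simp add: N_def algebra_simps)
    have n4: "4 * k\<^sup>2 \<le> n" "1 \<le> n" using n by auto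
    have "k * 1 \<le> k * k" using k by (intro mult_le_mono) auto
    then have "2 * k \<le> n" using n4(1) unfolding power2_eq_square by linarith
    then have N1: "1 \<le> N" using k div_le_mono[of "2 * k" n "2 * k"] by (simp add: N_def)
    \<comment> \<open>Since \<open>n\<close> is at least \<open>4 * k ^ 2\<close>, dividing it by
      \<open>2 * k\<close> loses at most its square root, hence at most half of its
      logarithm.\<close>
    have "n \<le> (N + 1)\<^sup>2"
    proof -
      have "4 * k\<^sup>2 * n \<le> n * n" using n4 by simp
      also have "\<dots> \<le> (2 * k * (N + 1)) * (2 * k * (N + 1))" using nN by (intro mult_le_mono) auto
      also have "\<dots> = 4 * k\<^sup>2 * (N + 1)\<^sup>2" by (simp add: power2_eq_square algebra_simps)
      finally show ?thesis using k by simp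
    qed
    then have "real n \<le> (real N + 1) ^ 2" by (metis of_nat_1 of_nat_add of_nat_mono of_nat_power)
    then have "ln (real n) \<le> ln ((real N + 1) ^ 2)" using n4 by (intro ln_mono) auto
    then have ln: "ln (real n) / 2 \<le> ln (real N + 1)" by (simp add: ln_realpow)
    have "n \<le> 4 * k * N"
    proof -
      have "2 * k * (N + 1) \<le> 2 * k * (2 * N)" using N1 by (intro mult_le_mono) auto
      also have "\<dots> = 4 * k * N" by simp
      finally show ?thesis using nN by linarith
    qed
    then have "real n \<le> real (4 * k * N)" by (simp only: of_nat_le_iff)
    then have "real n / (4 * real k) \<le> real N" using k by (simp add: field_simps)
    then have pow: "(real n / (4 * real k)) ^ (k * ?a) \<le> real N ^ (k * ?a)" by (intro power_mono) auto
    have "c * (real n ^ (k * ?a) * ln (real n)) = (real n / (4 * real k)) ^ (k * ?a) * (ln (real n) / 2 / 2 ^ (?a + 1))"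
      by (simp add: c_def power_divide)
    also have "\<dots> \<le> real N ^ (k * ?a) * (ln (real N + 1) / 2 ^ (?a + 1))"
      using pow ln n4 by (intro mult_mono divide_right_mono) auto
    also have "\<dots> \<le> real (card (low_rank n k :: ('a \<Rightarrow> 'b \<Rightarrow> int) set))"
      using k True by (intro card_low_rank_square_ge) (auto simp: N_def)
    finally show ?thesis .
  qed
  then have "eventually (\<lambda>n. c * norm (real n ^ (k * CARD('b)) * (if CARD('a) = CARD('b) then ln (real n) else 1))
      \<le> norm (real (card (low_rank n k :: ('a \<Rightarrow> 'b \<Rightarrow> int) set)))) at_top"
    using True by (intro eventually_mono[OF eventually_ge_at_top[of "4 * k ^ 2 + 1"]]) auto
  with c show ?thesis by (rule landau_omega.bigI)
qed

theorem proposition1p9: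
  fixes k :: nat
  assumes "0 < k" and "k < min CARD('d::finite) CARD('r::finite)"
  shows "(\<lambda>n. real (L_count n TYPE('d) k TYPE('r))) \<in> \<Theta>[at_top](l_bound CARD('d) k CARD('r))"
proof -
  have L: "L_count n TYPE('d) k TYPE('r) = card (low_rank n k :: ('d \<Rightarrow> 'r \<Rightarrow> int) set)" for n
    using assms by (intro L_count_eq_card_low_rank) simp
  show ?thesis
  proof (cases "CARD('d) \<le> CARD('r)")
    case True
    have bound: "l_bound CARD('d) k CARD('r)
        = (\<lambda>n. real n ^ (k * CARD('r)) * (if CARD('d) = CARD('r) then ln (real n) else 1))"
      using True by (auto simp: l_bound_def fun_eq_iff)
    show ?thesis
      unfolding L bound using assms True
      by (intro bigthetaI card_low_rank_bigo card_low_rank_bigomega) auto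
  next
    case False
    have bound: "l_bound CARD('d) k CARD('r)
        = (\<lambda>n. real n ^ (k * CARD('d)) * (if CARD('r) = CARD('d) then ln (real n) else 1))"
      using False by (auto simp: l_bound_def fun_eq_iff)
    show ?thesis
      unfolding L bound card_low_rank_transpose[where 'a = 'd and 'b = 'r] using assms False
      by (intro bigthetaI card_low_rank_bigo card_low_rank_bigomega) auto
  qed
qed

end
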